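(* Assume that $f$ is a lower-ordinary smooth density function of order $\beta_1>0$. Then the following holds. (a) When $g$ is an upper-supersmooth density function of order $\alpha>0$ and $\|g\|_\infty<\infty$, there exist universal constants $C$ and $C'$ such that as long as $R\ge C'$, we have $$\left|\mathbb{E}[\widehat g_{n,R}(\theta)]-g(\theta)\right|\le C\,R^{\max\{1-\alpha,0\}}\exp(-C_1R^\alpha),\qquad \mathrm{var}[\widehat g_{n,R}(\theta)]\le C\cdot\frac{R^{(2+2\beta_1)d}}{n},$$ for almost every $\theta\in\Theta$, where $C_1$ is the constant associated with the upper-supersmoothness of $g$. (b) When $g$ is an upper-ordinary smooth density function of order $\beta_2>1$ and $\|g\|_\infty<\infty$, there exist universal constants $c$ and $C$ such that for almost every $\theta\in\Theta$ we have $$\left|\mathbb{E}[\widehat g_{n,R}(\theta)]-g(\theta)\right|\le\frac{c}{R^{\beta_2-1}},\qquad \mathrm{var}[\widehat g_{n,R}(\theta)]\le C\cdot\frac{R^{(2+2\beta_1)d}}{n}.$$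
   Context: Deconvolution setting: $X_1,\dots,X_n$ are i.i.d. on $\mathcal X=\mathbb{R}^d$ with density $p_0(x)=\int_\Theta f(x-\theta)g(\theta)\,d\theta$, where $\Theta\subseteq\mathbb{R}^d$ is given, $f$ is a known density on $\mathbb{R}^d$ that is symmetric ($f(x)=f(-x)$ for all $x$), and $g$ is an unknown mixing density on $\Theta$ (extended by $0$ outside $\Theta$). Fourier transform: $\widehat h(s)=\int_{\mathbb{R}^d}h(t)e^{-is^\top t}\,dt$ (so $\widehat f$ is real). For $R>0$ the Fourier deconvolution estimator is $$\widehat g_{n,R}(\theta)=\frac{1}{n(2\pi)^d}\sum_{i=1}^n\int_{[-R,R]^d}\frac{\cos(s^\top(\theta-X_i))}{\widehat f(s)}\,ds.$$ A density $h$ is upper-supersmooth of order $\alpha$ if there are positive constants $C_0,C_1$ with $|\widehat h(s)|\le C_0\exp(-C_1\sum_{j=1}^d|s_j|^\alpha)$ for all $s\in\mathbb{R}^d$; upper-ordinary smooth (respectively lower-ordinary smooth) of order $\beta$ if there is a constant $c_0>0$ with $|\widehat h(s)|\le c_0\prod_{j=1}^d\frac{1}{1+|s_j|^\beta}$ (respectively $|\widehat h(s)|\ge c_0\prod_{j=1}^d\frac{1}{1+|s_j|^\beta}$) for all $s\in\mathbb{R}^d$. "Universal constant" means a positive constant not depending on $n$, $R$ or $\theta$ (it may depend on $d$, the smoothness orders and constants, $f$ and $g$).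
   Formalization: In (b) the variance bound is proved only for R ≥ C', for every C' > 0 with C depending on C'; for R → 0 it is false (d=1, f Laplace with β₁=2, g standard normal, n=1, θ near π/(2R): variance of order R⁴ against R⁶). The bias bound holds for all R > 0. *)

theory Defs
  imports "HOL-Probability.Probability" "HOL-Probability.Essential_Supremum"
begin

text \<open>The ambient space \<open>\<real>\<^sup>d\<close> is \<^typ>\<open>real ^ 'd\<close> with \<open>d = CARD('d)\<close>.\<close>

definition pdf :: "(real ^ 'd \<Rightarrow> real) \<Rightarrow> bool" where
  "pdf h \<longleftrightarrow> h \<in> borel_measurable borel \<and> (\<forall>x. 0 \<le> h x) \<and>
     (\<integral>\<^sup>+ x. ennreal (h x) \<partial>lborel) = 1"

text \<open>A density on \<open>\<Theta>\<close>, already extended by \<open>0\<close> to the whole space.\<close>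

definition pdf_on :: "(real ^ 'd) set \<Rightarrow> (real ^ 'd \<Rightarrow> real) \<Rightarrow> bool" where
  "pdf_on \<Theta> g \<longleftrightarrow> pdf g \<and> (\<forall>\<theta>. \<theta> \<notin> \<Theta> \<longrightarrow> g \<theta> = 0)"

definition fourier :: "(real ^ 'd \<Rightarrow> real) \<Rightarrow> real ^ 'd \<Rightarrow> complex" where
  "fourier h s = (CLINT t|lborel. complex_of_real (h t) * exp (- (\<i> * complex_of_real (s \<bullet> t))))"

definition upper_supersmooth ::
    "real \<Rightarrow> real \<Rightarrow> real \<Rightarrow> (real ^ 'd \<Rightarrow> real) \<Rightarrow> bool" where
  "upper_supersmooth \<alpha> C0 C1 h \<longleftrightarrow> C0 > 0 \<and> C1 > 0 \<and>
     (\<forall>s. norm (fourier h s) \<le> C0 * exp (- C1 * (\<Sum>j\<in>UNIV. \<bar>s $ j\<bar> powr \<alpha>)))"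

definition upper_ordinary_smooth :: "real \<Rightarrow> (real ^ 'd \<Rightarrow> real) \<Rightarrow> bool" where
  "upper_ordinary_smooth \<beta> h \<longleftrightarrow>
     (\<exists>c0>0. \<forall>s. norm (fourier h s) \<le> c0 * (\<Prod>j\<in>UNIV. 1 / (1 + \<bar>s $ j\<bar> powr \<beta>)))"

definition lower_ordinary_smooth :: "real \<Rightarrow> (real ^ 'd \<Rightarrow> real) \<Rightarrow> bool" where
  "lower_ordinary_smooth \<beta> h \<longleftrightarrow>
     (\<exists>c0>0. \<forall>s. norm (fourier h s) \<ge> c0 * (\<Prod>j\<in>UNIV. 1 / (1 + \<bar>s $ j\<bar> powr \<beta>)))"

definition mixture_pdf ::
    "(real ^ 'd) set \<Rightarrow> (real ^ 'd \<Rightarrow> real) \<Rightarrow> (real ^ 'd \<Rightarrow> real) \<Rightarrow> real ^ 'd \<Rightarrow> real" where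
  "mixture_pdf \<Theta> f g x = (LINT \<theta>:\<Theta>|lborel. f (x - \<theta>) * g \<theta>)"

definition iid_sample ::
    "'w measure \<Rightarrow> nat \<Rightarrow> (nat \<Rightarrow> 'w \<Rightarrow> real ^ 'd) \<Rightarrow> (real ^ 'd \<Rightarrow> real) \<Rightarrow> bool" where
  "iid_sample M n X p \<longleftrightarrow> prob_space M \<and>
     prob_space.indep_vars M (\<lambda>_. borel) X {1..n} \<and>
     (\<forall>i\<in>{1..n}. distributed M lborel (X i) (\<lambda>x. ennreal (p x)))"

text \<open>For symmetric \<open>f\<close> the Fourier transform is real, so taking the real part below is only a
  coercion from \<^typ>\<open>complex\<close> to \<^typ>\<open>real\<close>.\<close>

lemma fourier_real_if_symmetric:
  fixes f :: "real ^ 'd \<Rightarrow> real"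
  assumes f: "f \<in> borel_measurable borel" and sym: "\<And>x. f x = f (- x)"
  shows "complex_of_real (Re (fourier f s)) = fourier f s"
proof -
  let ?F = "\<lambda>t. complex_of_real (f t) * exp (- (\<i> * complex_of_real (s \<bullet> t)))"
  have reflect: "(lborel :: (real ^ 'd) measure) = distr lborel borel uminus"
    using lborel_affine [of "- 1" "0 :: real ^ 'd"] by (simp add: density_1)
  have F [measurable]: "?F \<in> borel_measurable borel"
    using f by measurable
  have "cnj (fourier f s) = (CLINT t|lborel. cnj (?F t))"
    unfolding fourier_def by (rule integral_bounded_linear' [OF bounded_linear_cnj bounded_linear_cnj, symmetric]) simp
  also have "\<dots> = (CLINT t|lborel. ?F (- t))"
    by (intro Bochner_Integration.integral_cong) (auto simp: exp_cnj sym [symmetric])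
  also have "\<dots> = (CLINT t|distr lborel borel uminus. ?F t)"
    by (subst integral_distr) auto
  also have "\<dots> = fourier f s"
    unfolding fourier_def reflect [symmetric] ..
  finally show ?thesis
    by (metis Reals_cnj_iff of_real_Re)
qed

text \<open>The points \<open>x 1, \<dots>, x n\<close> are the observed values of the sample.\<close>

definition deconv_estimator ::
    "(real ^ 'd \<Rightarrow> real) \<Rightarrow> nat \<Rightarrow> real \<Rightarrow> (nat \<Rightarrow> real ^ 'd) \<Rightarrow> real ^ 'd \<Rightarrow> real" where
  "deconv_estimator f n R x \<theta> =
     1 / (real n * (2 * pi) ^ CARD('d)) *
     (\<Sum>i=1..n. LINT s:cbox (\<chi> j. - R) (\<chi> j. R)|lborel.
        cos (s \<bullet> (\<theta> - x i)) / Re (fourier f s))"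

end

theory Submission
  imports Defs "HOL-Real_Asymp.Real_Asymp"
begin

text \<open>
  Let \<open>p\<close> be the mixture density, the convolution of \<open>f\<close> and \<open>g\<close>.  Its Fourier transform is the
  product of those of \<open>f\<close> and \<open>g\<close>, so dividing by the transform of \<open>f\<close> recovers that of \<open>g\<close>.  After
  Fubini, the mean of the estimator is therefore exactly the inversion integral
  \<open>(2 \<pi>)\<^sup>-\<^sup>d \<integral> Re (fourier g s * exp (i s \<bullet> \<theta>)) ds\<close> taken over the cube \<open>[-R, R]\<^sup>d\<close> only
  (lemma \<open>expectation_deconv_estimator\<close>).

  Bias: both smoothness classes make \<open>fourier g\<close> integrable, and then Fourier inversion holds almost
  everywhere (\<open>fourier_inversion_AE\<close>), so the bias is the part of the inversion integral outside the
  cube.  The bound on \<open>fourier g\<close> is a product of one-dimensional envelopes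
  \<open>h\<close>.  Outside the cube some coordinate exceeds \<open>R\<close> in modulus, so a union
  bound over the coordinates gives a constant times the tail \<open>\<integral>\<^bsub>\<bar>x\<bar> > R\<^esub> h\<close>
  (\<open>truncated_inversion_error\<close>).  The two rates are the sizes of this tail for
  \<open>h x = exp (- C1 * \<bar>x\<bar> powr \<alpha>)\<close> and for \<open>h x = 1 / (1 + \<bar>x\<bar> powr \<beta>2)\<close> (\<open>supersmooth_tail\<close>,
  \<open>ordinary_smooth_tail\<close>).

  Variance: the estimator is an average of \<open>n\<close> independent copies of a bounded variable.  The lower
  bound on the transform of \<open>f\<close> bounds the integrand by a constant times \<open>(1 + R powr \<beta>1) ^ d\<close> on the
  cube, whose volume is \<open>(2 * R) ^ d\<close>; up to a constant, the square of the product of these,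
  divided by \<open>n\<close>, is the variance bound (\<open>variance_deconv_estimator_le\<close>).

  Fourier inversion in dimension \<open>d\<close> is obtained by Gaussian smoothing.  Damping the inversion
  integral by a Gaussian of width \<open>1 / \<sigma>\<close> turns it into the convolution of \<open>g\<close> with a Gaussian of
  width \<open>\<sigma>\<close>, up to the factor \<open>(2 \<pi>)\<^sup>d\<close> (\<open>fourier_gauss_smooth\<close>).  As \<open>\<sigma>\<close> tends to \<open>0\<close> the damped
  integral converges pointwise to the undamped one, while the integral of the convolution
  over a box converges to that of \<open>g\<close>.  Hence the undamped integral
  \<open>\<integral> fourier g s * exp (i s \<bullet> \<theta>) ds\<close>, as a function of \<open>\<theta>\<close>, and \<open>(2 \<pi>)\<^sup>d g\<close> have the same
  integral over every box.  The undamped integral is real and nonnegative, being a limit of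
  nonnegative reals, so both are densities of measures that agree on boxes, and they coincide almost
  everywhere.
\<close>

section \<open>Integrals of products of coordinate functions\<close>

lemma prod_Basis_vec:
  "(\<Prod>b\<in>(Basis :: (real ^ 'd) set). F b (x \<bullet> b)) = (\<Prod>j\<in>UNIV. F (axis j 1) (x $ j))"
proof -
  have B: "(Basis :: (real ^ 'd) set) = (\<lambda>j. axis j 1) ` UNIV"
    by (auto simp: Basis_vec_def)
  show ?thesis
    unfolding B by (subst prod.reindex) (auto simp: inj_on_def axis_eq_axis inner_axis)
qed

text \<open>Lebesgue measure on \<open>\<real>\<^sup>d\<close> is the image of a product of one-dimensional Lebesgue measures, so
  integrals of products factor.  The underlying product is indexed by basis vectors; \<open>F\<close> in the
  proof moves the factors from coordinate indices to basis vectors.\<close>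

lemma
  fixes h :: "'d::finite \<Rightarrow> real \<Rightarrow> _::{real_normed_field,banach,second_countable_topology}"
  assumes h: "\<And>j. integrable lborel (h j)"
  shows integrable_prod_coordinates: "integrable lborel (\<lambda>x::real ^ 'd. \<Prod>j\<in>UNIV. h j (x $ j))"
    and integral_prod_coordinates:
      "(LINT x|lborel. (\<Prod>j\<in>UNIV. h j ((x::real ^ 'd) $ j))) = (\<Prod>j\<in>UNIV. LINT y|lborel. h j y)"
proof -
  interpret P: product_sigma_finite "\<lambda>_::real ^ 'd. lborel :: real measure" ..
  define F :: "real ^ 'd \<Rightarrow> real \<Rightarrow> _" where "F b = h (THE j. b = axis j 1)" for b
  have Fa: "F (axis j 1) = h j" for j
    by (simp add: F_def axis_eq_axis)
  have Fi: "integrable lborel (F b)" for b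
    using h by (simp add: F_def)
  have [measurable]: "F b \<in> borel_measurable borel" for b
    using Fi[of b] by auto
  have E: "(\<lambda>x::real ^ 'd. \<Prod>j\<in>UNIV. h j (x $ j)) = (\<lambda>x. \<Prod>b\<in>Basis. F b (x \<bullet> b))"
    by (simp add: prod_Basis_vec Fa)
  have S: "(\<Prod>b\<in>Basis. F b ((\<Sum>c\<in>Basis. y c *\<^sub>R c) \<bullet> b)) = (\<Prod>b\<in>Basis. F b (y b))" for y :: "real ^ 'd \<Rightarrow> real"
    by (intro prod.cong refl) simp
  show "integrable lborel (\<lambda>x::real ^ 'd. \<Prod>j\<in>UNIV. h j (x $ j))"
    unfolding E by (subst lborel_eq, subst integrable_distr_eq)
      (auto simp: S intro!: P.product_integrable_prod Fi)
  have "(LINT x|lborel. (\<Prod>b\<in>Basis. F b ((x::real ^ 'd) \<bullet> b))) = (\<Prod>b\<in>Basis. LINT y|lborel. F b y)"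
    by (subst lborel_eq, subst integral_distr)
      (auto simp: S intro!: P.product_integral_prod Fi)
  also have "\<dots> = (\<Prod>j\<in>UNIV. LINT y|lborel. h j y)"
    using prod_Basis_vec[of "\<lambda>b _. LINT y|lborel. F b y"] by (simp add: Fa)
  finally show "(LINT x|lborel. (\<Prod>j\<in>UNIV. h j ((x::real ^ 'd) $ j))) = (\<Prod>j\<in>UNIV. LINT y|lborel. h j y)"
    by (simp add: E)
qed

section \<open>The Gaussian and its Fourier transform\<close>

text \<open>Unnormalised: in this form the Fourier transform is a multiple of the function itself, and the value
  at \<open>0\<close> is \<open>1\<close>, as a damping factor requires.\<close>

definition gauss :: "real ^ 'd \<Rightarrow> real" where
  "gauss u = exp (- (u \<bullet> u) / 2)"

lemma gauss_measurable [measurable]: "gauss \<in> borel_measurable borel"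
  unfolding gauss_def by measurable

lemma gauss_prod: "gauss u = (\<Prod>j\<in>UNIV. exp (- (u $ j)\<^sup>2 / 2))"
  by (simp add: gauss_def inner_vec_def exp_sum sum_divide_distrib sum_negf power2_eq_square flip: exp_sum)

lemma gauss_nonneg: "0 \<le> gauss u" and gauss_le_1: "gauss u \<le> 1" and gauss_0: "gauss 0 = 1"
  and gauss_minus: "gauss (- u) = gauss u"
  by (auto simp: gauss_def)

lemma continuous_gauss: "continuous_on UNIV gauss"
  unfolding gauss_def by (intro continuous_intros) auto

text \<open>The known characteristic function of the standard normal distribution, freed from its normalising
  constant.\<close>

lemma has_bochner_integral_gauss_iexp_real:
  "has_bochner_integral lborel (\<lambda>x. complex_of_real (exp (- x\<^sup>2 / 2)) * iexp (t * x))
     (complex_of_real (sqrt (2 * pi) * exp (- t\<^sup>2 / 2)))"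
proof -
  have i: "integrable lborel (\<lambda>x. std_normal_density x *\<^sub>R iexp (t * x))"
    by (rule Bochner_Integration.integrable_bound[OF integrable_normal_density[of 1 0]]) auto
  have "(CLINT x|lborel. std_normal_density x *\<^sub>R iexp (t * x)) = char std_normal_distribution t"
    unfolding char_def by (subst integral_density) auto
  then have "has_bochner_integral lborel (\<lambda>x. std_normal_density x *\<^sub>R iexp (t * x)) (complex_of_real (exp (- (t\<^sup>2) / 2)))"
    using i by (simp add: has_bochner_integral_iff char_std_normal_distribution)
  from has_bochner_integral_mult_right[OF this, of "complex_of_real (sqrt (2 * pi))"]
  show ?thesis
    by (simp add: std_normal_density_def scaleR_conv_of_real)
qed

lemma
  fixes t :: "real ^ 'd"
  shows integrable_gauss_iexp: "integrable lborel (\<lambda>u. complex_of_real (gauss u) * iexp (u \<bullet> t))"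
    and integral_gauss_iexp: "(CLINT u|lborel. complex_of_real (gauss u) * iexp (u \<bullet> t)) =
      complex_of_real (sqrt (2 * pi) ^ CARD('d) * gauss t)"
proof -
  have E: "complex_of_real (gauss u) * iexp (u \<bullet> t) =
     (\<Prod>j\<in>UNIV. complex_of_real (exp (- (u $ j)\<^sup>2 / 2)) * iexp (t $ j * u $ j))" for u
  proof -
    have "iexp (u \<bullet> t) = (\<Prod>j\<in>UNIV. iexp (t $ j * u $ j))"
      by (simp add: inner_vec_def sum_distrib_left mult.commute flip: exp_sum)
    then show ?thesis
      by (simp only: gauss_prod prod.distrib of_real_prod)
  qed
  note H = has_bochner_integral_gauss_iexp_real[unfolded has_bochner_integral_iff]
  show "integrable lborel (\<lambda>u. complex_of_real (gauss u) * iexp (u \<bullet> t))"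
    unfolding E by (rule integrable_prod_coordinates[where h = "\<lambda>j x. complex_of_real (exp (- x\<^sup>2 / 2)) * iexp (t $ j * x)"]) (use H in blast)
  have "(CLINT u|lborel. complex_of_real (gauss u) * iexp (u \<bullet> t)) =
     (\<Prod>j\<in>UNIV. CLINT x|lborel. complex_of_real (exp (- x\<^sup>2 / 2)) * iexp (t $ j * x))"
    unfolding E by (rule integral_prod_coordinates) (use H in blast)
  also have "\<dots> = (\<Prod>j\<in>UNIV. complex_of_real (sqrt (2 * pi) * exp (- (t $ j)\<^sup>2 / 2)))"
    by (intro prod.cong refl) (use H in blast)
  also have "\<dots> = complex_of_real (sqrt (2 * pi) ^ CARD('d) * gauss t)"
    by (simp add: gauss_prod prod.distrib)
  finally show "(CLINT u|lborel. complex_of_real (gauss u) * iexp (u \<bullet> t)) =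
      complex_of_real (sqrt (2 * pi) ^ CARD('d) * gauss t)" .
qed

lemma
  shows integrable_gauss: "integrable lborel (gauss :: real ^ 'd \<Rightarrow> real)"
    and integral_gauss: "(LINT u|lborel. gauss (u :: real ^ 'd)) = sqrt (2 * pi) ^ CARD('d)"
proof -
  have "integrable lborel (\<lambda>u::real ^ 'd. complex_of_real (gauss u))"
    using integrable_gauss_iexp[of 0] by simp
  from integrable_bounded_linear[OF bounded_linear_Re this]
  show "integrable lborel (gauss :: real ^ 'd \<Rightarrow> real)"
    by simp
  have "complex_of_real (LINT u|lborel. gauss (u :: real ^ 'd)) = complex_of_real (sqrt (2 * pi) ^ CARD('d))"
    using integral_gauss_iexp[of "0 :: real ^ 'd"] by (simp add: gauss_0)
  then show "(LINT u|lborel. gauss (u :: real ^ 'd)) = sqrt (2 * pi) ^ CARD('d)"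
    unfolding of_real_eq_iff .
qed

section \<open>Affine substitution and product kernels\<close>

lemma
  fixes F :: "'a::euclidean_space \<Rightarrow> 'b::{banach,second_countable_topology}" and t :: 'a
  assumes F [measurable]: "F \<in> borel_measurable borel" and c: "c > 0"
  shows lborel_integral_affine: "(LINT x|lborel. F x) = c ^ DIM('a) *\<^sub>R (LINT x|lborel. F (t + c *\<^sub>R x))"
    and lborel_integrable_affine: "integrable lborel F \<Longrightarrow> integrable lborel (\<lambda>x. F (t + c *\<^sub>R x))"
proof -
  have D: "(lborel :: 'a measure) = density (distr lborel borel (\<lambda>x. t + c *\<^sub>R x)) (\<lambda>_. ennreal (c ^ DIM('a)))"
    using lborel_affine[of c t] c by simp
  show "(LINT x|lborel. F x) = c ^ DIM('a) *\<^sub>R (LINT x|lborel. F (t + c *\<^sub>R x))"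
    using c by (subst D, subst integral_density) (auto simp: integral_distr)
  show "integrable lborel (\<lambda>x. F (t + c *\<^sub>R x))" if "integrable lborel F"
  proof -
    have "integrable lborel (\<lambda>x. c ^ DIM('a) *\<^sub>R F (t + c *\<^sub>R x))"
      using that c by (subst (asm) D, subst (asm) integrable_density) (auto simp: integrable_distr_eq)
    from integrable_scaleR_right[of "inverse (c ^ DIM('a))", OF this] show ?thesis
      using c by simp
  qed
qed

lemma integrable_pair_mult:
  fixes f :: "'a::euclidean_space \<Rightarrow> real" and g :: "'b::euclidean_space \<Rightarrow> real"
  assumes f: "integrable lborel f" and g: "integrable lborel g"
  shows "integrable (lborel \<Otimes>\<^sub>M lborel) (\<lambda>(x, y). f x * g y)"
proof -
  have [measurable]: "f \<in> borel_measurable borel" "g \<in> borel_measurable borel"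
    using f g by auto
  show ?thesis
    by (rule lborel_pair.Fubini_integrable)
      (use f g in \<open>auto simp: abs_mult\<close>)
qed

section \<open>Fourier inversion almost everywhere\<close>

lemma fourier_eq_iexp: "fourier h s = (CLINT t|lborel. complex_of_real (h t) * iexp (- (s \<bullet> t)))"
  by (simp add: fourier_def)

lemma borel_measurable_fourier [measurable]:
  assumes [measurable]: "h \<in> borel_measurable borel"
  shows "fourier h \<in> borel_measurable borel"
  unfolding fourier_def by measurable

text \<open>This is \<open>(2 \<pi>)\<^sup>d\<close> times the convolution of \<open>g\<close> with the centred Gaussian density of
  covariance \<open>\<sigma>\<^sup>2 I\<close>: the explicit factor and the total mass of \<open>gauss\<close> are both \<open>sqrt (2 \<pi>)\<^sup>d\<close>.\<close>

definition gauss_smooth :: "(real ^ 'd \<Rightarrow> real) \<Rightarrow> real \<Rightarrow> real ^ 'd \<Rightarrow> real" where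
  "gauss_smooth g \<sigma> \<theta> = sqrt (2 * pi) ^ CARD('d) / \<sigma> ^ CARD('d) *
     (LINT t|lborel. g t * gauss ((t - \<theta>) /\<^sub>R \<sigma>))"

lemma gauss_smooth_nonneg:
  assumes "\<And>x. 0 \<le> g x" "\<sigma> > 0"
  shows "0 \<le> gauss_smooth g \<sigma> \<theta>"
  unfolding gauss_smooth_def using assms
  by (intro mult_nonneg_nonneg Bochner_Integration.integral_nonneg divide_nonneg_nonneg gauss_nonneg) auto

lemma integrable_gauss_scaled:
  assumes "\<sigma> > 0"
  shows "integrable lborel (\<lambda>u::real ^ 'd. gauss (\<sigma> *\<^sub>R u))"
  using lborel_integrable_affine[of gauss \<sigma> "0 :: real ^ 'd"] integrable_gauss assms by simp

lemma integral_gauss_scaled_iexp: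
  fixes t :: "real ^ 'd"
  assumes \<sigma>: "\<sigma> > 0"
  shows "(CLINT s|lborel. complex_of_real (gauss (\<sigma> *\<^sub>R s)) * iexp (s \<bullet> t)) =
    complex_of_real (sqrt (2 * pi) ^ CARD('d) / \<sigma> ^ CARD('d) * gauss (t /\<^sub>R \<sigma>))"
proof -
  have "complex_of_real (sqrt (2 * pi) ^ CARD('d) * gauss (t /\<^sub>R \<sigma>)) =
      (CLINT u|lborel. complex_of_real (gauss u) * iexp (u \<bullet> (t /\<^sub>R \<sigma>)))"
    by (rule integral_gauss_iexp[symmetric])
  also have "\<dots> = \<sigma> ^ CARD('d) *\<^sub>R (CLINT s|lborel. complex_of_real (gauss (\<sigma> *\<^sub>R s)) * iexp (s \<bullet> t))"
  proof -
    have "(\<sigma> *\<^sub>R s) \<bullet> (t /\<^sub>R \<sigma>) = s \<bullet> t" for s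
      using \<sigma> by simp
    then show ?thesis
      using \<sigma> by (subst lborel_integral_affine[where c = \<sigma> and t = 0]) (auto simp del: inner_scaleR_left inner_scaleR_right)
  qed
  finally show ?thesis
    using \<sigma> by (simp add: scaleR_conv_of_real field_simps)
qed

text \<open>Writing out \<open>fourier g\<close> and exchanging the integrals leaves \<open>g\<close> integrated against the
  Fourier transform of a scaled Gaussian at \<open>\<theta> - t\<close>.  The damping factor makes the double integral
  absolutely convergent.\<close>

lemma fourier_gauss_smooth:
  fixes g :: "real ^ 'd \<Rightarrow> real"
  assumes g: "integrable lborel g" and \<sigma>: "\<sigma> > 0"
  shows "(CLINT s|lborel. fourier g s * iexp (s \<bullet> \<theta>) * complex_of_real (gauss (\<sigma> *\<^sub>R s))) =
    complex_of_real (gauss_smooth g \<sigma> \<theta>)"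
proof -
  have [measurable]: "g \<in> borel_measurable borel"
    using g by auto
  define k where "k s t = complex_of_real (g t * gauss (\<sigma> *\<^sub>R s)) * iexp (s \<bullet> (\<theta> - t))" for s t
  have k: "integrable (lborel \<Otimes>\<^sub>M lborel) (\<lambda>(s, t). k s t)"
    by (rule Bochner_Integration.integrable_bound[OF integrable_pair_mult[OF integrable_gauss_scaled[OF \<sigma>] g]])
      (auto simp: k_def norm_mult abs_mult)
  have "(CLINT s|lborel. fourier g s * iexp (s \<bullet> \<theta>) * complex_of_real (gauss (\<sigma> *\<^sub>R s))) =
      (CLINT s|lborel. CLINT t|lborel. k s t)"
  proof (intro Bochner_Integration.integral_cong refl)
    fix s
    have *: "integrable lborel (\<lambda>t. complex_of_real (g t) * iexp (- (s \<bullet> t)))"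
      by (rule Bochner_Integration.integrable_bound[OF g]) (auto simp: norm_mult)
    have "fourier g s * (iexp (s \<bullet> \<theta>) * complex_of_real (gauss (\<sigma> *\<^sub>R s))) =
      (CLINT t|lborel. complex_of_real (g t) * iexp (- (s \<bullet> t)) * (iexp (s \<bullet> \<theta>) * complex_of_real (gauss (\<sigma> *\<^sub>R s))))"
      unfolding fourier_eq_iexp by (rule Bochner_Integration.integral_mult_left[symmetric]) (rule *)
    also have "\<dots> = (CLINT t|lborel. k s t)"
      by (intro Bochner_Integration.integral_cong refl)
        (simp add: k_def inner_diff_right right_diff_distrib exp_diff exp_minus field_simps)
    finally show "fourier g s * iexp (s \<bullet> \<theta>) * complex_of_real (gauss (\<sigma> *\<^sub>R s)) = (CLINT t|lborel. k s t)"
      by (simp add: mult.assoc)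
  qed
  also have "\<dots> = (CLINT t|lborel. CLINT s|lborel. k s t)"
    by (rule lborel_pair.Fubini_integral[OF k, symmetric])
  also have "\<dots> = (CLINT t|lborel. complex_of_real (sqrt (2 * pi) ^ CARD('d) / \<sigma> ^ CARD('d) * (g t * gauss ((t - \<theta>) /\<^sub>R \<sigma>))))"
  proof (intro Bochner_Integration.integral_cong refl)
    fix t
    have "(CLINT s|lborel. k s t) =
      (CLINT s|lborel. complex_of_real (g t) * (complex_of_real (gauss (\<sigma> *\<^sub>R s)) * iexp (s \<bullet> (\<theta> - t))))"
      by (intro Bochner_Integration.integral_cong refl) (simp add: k_def)
    also have "\<dots> = complex_of_real (g t) * complex_of_real (sqrt (2 * pi) ^ CARD('d) / \<sigma> ^ CARD('d) * gauss ((\<theta> - t) /\<^sub>R \<sigma>))"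
      by (simp only: integral_mult_right_zero integral_gauss_scaled_iexp[OF \<sigma>])
    also have "gauss ((\<theta> - t) /\<^sub>R \<sigma>) = gauss ((t - \<theta>) /\<^sub>R \<sigma>)"
      using gauss_minus[of "(t - \<theta>) /\<^sub>R \<sigma>"] by (simp add: scaleR_diff_right)
    finally show "(CLINT s|lborel. k s t) = complex_of_real (sqrt (2 * pi) ^ CARD('d) / \<sigma> ^ CARD('d) * (g t * gauss ((t - \<theta>) /\<^sub>R \<sigma>)))"
      by simp
  qed
  also have "\<dots> = complex_of_real (gauss_smooth g \<sigma> \<theta>)"
    by (simp only: integral_complex_of_real integral_mult_right_zero gauss_smooth_def)
  finally show ?thesis .
qed

text \<open>Moving the smoothing from \<open>g\<close> to the indicator of the box, where its limit can be computed
  pointwise.\<close>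

lemma box_integral_gauss_smooth:
  fixes g :: "real ^ 'd \<Rightarrow> real"
  assumes g: "integrable lborel g" and \<sigma>: "\<sigma> > 0"
  shows "(LINT \<theta>|lborel. indicator (box a b) \<theta> * gauss_smooth g \<sigma> \<theta>) =
    sqrt (2 * pi) ^ CARD('d) * (LINT t|lborel. g t * (LINT u|lborel. indicator (box a b) (t + \<sigma> *\<^sub>R u) * gauss u))"
proof -
  have [measurable]: "g \<in> borel_measurable borel"
    using g by auto
  let ?B = "indicator (box a b) :: real ^ 'd \<Rightarrow> real"
  let ?c = "sqrt (2 * pi) ^ CARD('d)"
  define k where "k \<theta> t = ?B \<theta> * (g t * gauss ((t - \<theta>) /\<^sub>R \<sigma>))" for \<theta> t
  have iB: "integrable lborel ?B"
    by (auto intro!: integrable_real_indicator emeasure_bounded_finite)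
  have k: "integrable (lborel \<Otimes>\<^sub>M lborel) (\<lambda>(s, t). k s t)"
    by (rule Bochner_Integration.integrable_bound[OF integrable_pair_mult[OF iB g]])
      (auto simp: k_def abs_mult gauss_nonneg gauss_le_1 intro!: AE_I2 mult_left_le split: split_indicator)
  have "(LINT \<theta>|lborel. ?B \<theta> * gauss_smooth g \<sigma> \<theta>) = (LINT \<theta>|lborel. ?c / \<sigma> ^ CARD('d) * (LINT t|lborel. k \<theta> t))"
    unfolding gauss_smooth_def k_def by (intro Bochner_Integration.integral_cong refl) simp
  also have "\<dots> = ?c / \<sigma> ^ CARD('d) * (LINT t|lborel. LINT \<theta>|lborel. k \<theta> t)"
    by (simp only: integral_mult_right_zero lborel_pair.Fubini_integral[OF k])
  also have "(LINT t|lborel. LINT \<theta>|lborel. k \<theta> t) =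
      (LINT t|lborel. \<sigma> ^ CARD('d) * (g t * (LINT u|lborel. ?B (t + \<sigma> *\<^sub>R u) * gauss u)))"
  proof (intro Bochner_Integration.integral_cong refl)
    fix t
    have "(LINT \<theta>|lborel. k \<theta> t) = g t * (LINT \<theta>|lborel. ?B \<theta> * gauss ((t - \<theta>) /\<^sub>R \<sigma>))"
      unfolding k_def by (subst integral_mult_right_zero[symmetric], intro Bochner_Integration.integral_cong refl) simp
    also have "(LINT \<theta>|lborel. ?B \<theta> * gauss ((t - \<theta>) /\<^sub>R \<sigma>)) =
        \<sigma> ^ CARD('d) * (LINT u|lborel. ?B (t + \<sigma> *\<^sub>R u) * gauss ((t - (t + \<sigma> *\<^sub>R u)) /\<^sub>R \<sigma>))"
      using \<sigma> by (subst lborel_integral_affine[where c = \<sigma> and t = t]) auto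
    also have "(\<lambda>u. ?B (t + \<sigma> *\<^sub>R u) * gauss ((t - (t + \<sigma> *\<^sub>R u)) /\<^sub>R \<sigma>)) = (\<lambda>u. ?B (t + \<sigma> *\<^sub>R u) * gauss u)"
      using \<sigma> by (simp add: gauss_minus)
    finally show "(LINT \<theta>|lborel. k \<theta> t) = \<sigma> ^ CARD('d) * (g t * (LINT u|lborel. ?B (t + \<sigma> *\<^sub>R u) * gauss u))"
      by (simp only: mult.left_commute)
  qed
  finally show ?thesis
    using \<sigma> by simp
qed

text \<open>The Fourier inversion integral without its constant \<open>(2 \<pi>)\<^sup>-\<^sup>d\<close>.\<close>

definition fourier_inv_int :: "(real ^ 'd \<Rightarrow> real) \<Rightarrow> real ^ 'd \<Rightarrow> complex" where
  "fourier_inv_int g \<theta> = (CLINT s|lborel. fourier g s * iexp (s \<bullet> \<theta>))"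

lemma gauss_smooth_tendsto:
  fixes g :: "real ^ 'd \<Rightarrow> real"
  assumes g: "integrable lborel g" and G: "integrable lborel (fourier g)"
  shows "(\<lambda>k. complex_of_real (gauss_smooth g (1 / real (Suc k)) \<theta>)) \<longlonglongrightarrow> fourier_inv_int g \<theta>"
proof -
  have [measurable]: "g \<in> borel_measurable borel"
    using g by auto
  have "(\<lambda>k. (CLINT s|lborel. fourier g s * iexp (s \<bullet> \<theta>) * complex_of_real (gauss ((1 / real (Suc k)) *\<^sub>R s)))) \<longlonglongrightarrow>
     (CLINT s|lborel. fourier g s * iexp (s \<bullet> \<theta>))"
  proof (rule integral_dominated_convergence[where w = "\<lambda>s. norm (fourier g s)"])
    have "(\<lambda>k. fourier g s * iexp (s \<bullet> \<theta>) * complex_of_real (gauss ((1 / real (Suc k)) *\<^sub>R s)))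
      \<longlonglongrightarrow> fourier g s * iexp (s \<bullet> \<theta>) * complex_of_real (gauss (0 *\<^sub>R s))" for s :: "real ^ 'd"
      by (intro tendsto_intros continuous_on_tendsto_compose[OF continuous_gauss] LIMSEQ_Suc[OF lim_1_over_n]) auto
    then show "AE s in lborel. (\<lambda>k. fourier g s * iexp (s \<bullet> \<theta>) * complex_of_real (gauss ((1 / real (Suc k)) *\<^sub>R s)))
      \<longlonglongrightarrow> fourier g s * iexp (s \<bullet> \<theta>)"
      by (simp add: gauss_0)
  qed (use G in \<open>auto simp: norm_mult gauss_nonneg gauss_le_1 intro!: mult_left_le\<close>)
  then show ?thesis
    by (subst (asm) fourier_gauss_smooth[OF g]) (auto simp: fourier_inv_int_def)
qed

lemma null_sets_frontier_box: "frontier (box a b :: (real ^ 'd) set) \<in> null_sets lborel"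
  using negligible_convex_frontier[of "box a b"]
  by (auto simp: negligible_iff_null_sets null_sets_completion_iff)

text \<open>The indicator of \<open>B\<close> is locally constant off the frontier of \<open>B\<close>.\<close>

lemma indicator_translate_tendsto:
  fixes t u :: "real ^ 'd"
  assumes t: "t \<notin> frontier B" and e: "e \<longlonglongrightarrow> 0"
  shows "(\<lambda>k. indicator B (t + e k *\<^sub>R u) :: real) \<longlonglongrightarrow> indicator B t"
proof -
  have lim: "(\<lambda>k. t + e k *\<^sub>R u) \<longlonglongrightarrow> t"
    using tendsto_add[OF tendsto_const tendsto_scaleR[OF e tendsto_const], of t u] by simp
  consider "t \<in> interior B" | "t \<in> - closure B"
    using t by (auto simp: frontier_def)
  then have "eventually (\<lambda>k. indicator B (t + e k *\<^sub>R u) = (indicator B t :: real)) sequentially"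
  proof cases
    case 1
    with topological_tendstoD[OF lim open_interior 1] show ?thesis
      using interior_subset by (auto elim!: eventually_mono simp: indicator_def)
  next
    case 2
    have "open (- closure B)" by auto
    from topological_tendstoD[OF lim this 2] 2 show ?thesis
      using closure_subset by (fastforce elim!: eventually_mono simp: indicator_def)
  qed
  then show ?thesis
    by (rule tendsto_eventually)
qed

text \<open>Two applications of dominated convergence: the smoothed indicator of the box converges off the null
  frontier, with bound the total mass of \<open>gauss\<close>, and so its integral against \<open>g\<close> converges.\<close>

lemma box_integral_gauss_smooth_tendsto:
  fixes g :: "real ^ 'd \<Rightarrow> real"
  assumes g: "integrable lborel g" and g0: "\<And>x. 0 \<le> g x"
  shows "(\<lambda>k. LINT \<theta>|lborel. indicator (box a b) \<theta> * gauss_smooth g (1 / real (Suc k)) \<theta>)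
    \<longlonglongrightarrow> (2 * pi) ^ CARD('d) * (LINT t|lborel. indicator (box a b) t * g t)"
proof -
  have [measurable]: "g \<in> borel_measurable borel"
    using g by auto
  let ?B = "indicator (box a b) :: real ^ 'd \<Rightarrow> real"
  let ?c = "sqrt (2 * pi) ^ CARD('d)"
  define J where "J k t = (LINT u|lborel. ?B (t + (1 / real (Suc k)) *\<^sub>R u) * gauss u)" for k t
  have [measurable]: "J k \<in> borel_measurable borel" for k
    unfolding J_def by measurable
  have J: "(\<lambda>k. J k t) \<longlonglongrightarrow> ?B t * ?c" if "t \<notin> frontier (box a b)" for t
  proof -
    have "(\<lambda>k. J k t) \<longlonglongrightarrow> (LINT u|lborel. ?B t * gauss (u :: real ^ 'd))"
      unfolding J_def
    proof (rule integral_dominated_convergence[where w = gauss])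
      show "AE u in lborel. (\<lambda>k. ?B (t + (1 / real (Suc k)) *\<^sub>R u) * gauss u) \<longlonglongrightarrow> ?B t * gauss u"
        by (intro AE_I2 tendsto_intros indicator_translate_tendsto that LIMSEQ_Suc[OF lim_1_over_n])
    qed (auto simp: integrable_gauss gauss_nonneg split: split_indicator)
    then show ?thesis
      by (simp add: integral_gauss)
  qed
  have J_bound: "\<bar>J k t\<bar> \<le> ?c" for k t
  proof -
    have "\<bar>J k t\<bar> \<le> (LINT u|lborel. gauss (u :: real ^ 'd))"
      unfolding J_def
      by (rule integral_abs_bound_integral)
        (auto intro!: Bochner_Integration.integrable_bound[OF integrable_gauss] integrable_gauss simp: gauss_nonneg split: split_indicator)
    then show ?thesis
      by (simp add: integral_gauss)
  qed
  have "(\<lambda>k. LINT t|lborel. g t * J k t) \<longlonglongrightarrow> (LINT t|lborel. g t * (?B t * ?c))"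
  proof (rule integral_dominated_convergence[where w = "\<lambda>t. g t * ?c"])
    show "AE t in lborel. (\<lambda>k. g t * J k t) \<longlonglongrightarrow> g t * (?B t * ?c)"
      using AE_not_in[OF null_sets_frontier_box[of a b]]
      by eventually_elim (intro tendsto_intros J)
  qed (use g g0 J_bound in \<open>auto simp: abs_mult intro!: mult_left_mono\<close>)
  then have "(\<lambda>k. ?c * (LINT t|lborel. g t * J k t)) \<longlonglongrightarrow> ?c * (LINT t|lborel. g t * (?B t * ?c))"
    by (intro tendsto_intros)
  also have "?c * (LINT t|lborel. g t * (?B t * ?c)) = ?c * (?c * (LINT t|lborel. ?B t * g t))"
    by (subst integral_mult_right_zero[symmetric]) (simp add: mult_ac)
  also have "\<dots> = (2 * pi) ^ CARD('d) * (LINT t|lborel. ?B t * g t)"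
  proof -
    have "?c * ?c = (sqrt (2 * pi) * sqrt (2 * pi)) ^ CARD('d)"
      by (rule power_mult_distrib[symmetric])
    then show ?thesis
      by (simp only: mult.assoc[symmetric]) simp
  qed
  also have "(\<lambda>k. ?c * (LINT t|lborel. g t * J k t)) = (\<lambda>k. LINT \<theta>|lborel. ?B \<theta> * gauss_smooth g (1 / real (Suc k)) \<theta>)"
    unfolding J_def by (intro ext box_integral_gauss_smooth[symmetric] g) simp
  finally show ?thesis .
qed

text \<open>Open boxes form an intersection-stable generator of the Borel sets, so the measures with densities
  \<open>f\<close> and \<open>g\<close> are equal, and densities are unique almost everywhere.\<close>

lemma AE_eq_if_box_integrals_eq:
  fixes f g :: "real ^ 'd \<Rightarrow> real"
  assumes [measurable]: "f \<in> borel_measurable borel" "g \<in> borel_measurable borel"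
    and f0: "\<And>x. 0 \<le> f x" and g0: "\<And>x. 0 \<le> g x"
    and f: "\<And>a b. integrable lborel (\<lambda>x. indicator (box a b) x * f x)"
    and g: "\<And>a b. integrable lborel (\<lambda>x. indicator (box a b) x * g x)"
    and eq: "\<And>a b. (LINT x|lborel. indicator (box a b) x * f x) = (LINT x|lborel. indicator (box a b) x * g x)"
  shows "AE x in lborel. f x = g x"
proof -
  have em: "emeasure (density lborel (\<lambda>x. ennreal (h x))) (box a b) = ennreal (LINT x|lborel. indicator (box a b) x * h x)"
    if [measurable]: "h \<in> borel_measurable borel" and h0: "\<And>x. 0 \<le> h x"
      and h: "integrable lborel (\<lambda>x. indicator (box a b) x * h x)" for h :: "real ^ 'd \<Rightarrow> real" and a b
  proof -
    have "emeasure (density lborel (\<lambda>x. ennreal (h x))) (box a b) = (\<integral>\<^sup>+x. ennreal (indicator (box a b) x * h x) \<partial>lborel)"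
      by (subst emeasure_density) (auto intro!: nn_integral_cong split: split_indicator)
    then show ?thesis
      using h h0 by (simp add: nn_integral_eq_integral)
  qed
  have "density lborel (\<lambda>x. ennreal (f x)) = density lborel (\<lambda>x. ennreal (g x))"
  proof (rule measure_eqI_generator_eq)
    let ?E = "range (\<lambda>(a, b). box a b :: (real ^ 'd) set)"
    show "Int_stable ?E"
      by (auto simp: Int_stable_def box_Int_box)
    show "?E \<subseteq> Pow UNIV" "sets (density lborel (\<lambda>x. ennreal (f x))) = sigma_sets UNIV ?E"
      "sets (density lborel (\<lambda>x. ennreal (g x))) = sigma_sets UNIV ?E"
      by (simp_all add: borel_eq_box)
    let ?A = "\<lambda>n::nat. box (- (real n *\<^sub>R One)) (real n *\<^sub>R One) :: (real ^ 'd) set"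
    show "range ?A \<subseteq> ?E" "(\<Union>i. ?A i) = UNIV"
      unfolding UN_box_eq_UNIV by auto
    show "emeasure (density lborel (\<lambda>x. ennreal (f x))) (?A i) \<noteq> \<infinity>" for i
      by (subst em) (use f f0 in auto)
    show "emeasure (density lborel (\<lambda>x. ennreal (f x))) X = emeasure (density lborel (\<lambda>x. ennreal (g x))) X" if "X \<in> ?E" for X
      using that by (auto simp: em f g f0 g0 eq)
  qed
  then have "AE x in lborel. ennreal (f x) = ennreal (g x)"
    by (subst (asm) sigma_finite_measure.density_unique_iff[OF sigma_finite_lborel]) auto
  then show ?thesis
    by eventually_elim (use f0 g0 in simp)
qed

text \<open>The inversion integral is the pointwise limit of the nonnegative functions \<open>gauss_smooth g \<sigma>\<close>,
  which the \<open>L\<^sup>1\<close> norm of \<open>fourier g\<close> bounds uniformly; hence it is real and nonnegative and its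
  integrals over boxes are limits of theirs.\<close>

theorem fourier_inversion_AE:
  fixes g :: "real ^ 'd \<Rightarrow> real"
  assumes g: "integrable lborel g" and g0: "\<And>x. 0 \<le> g x" and G: "integrable lborel (fourier g)"
  shows "AE \<theta> in lborel. fourier_inv_int g \<theta> = complex_of_real ((2 * pi) ^ CARD('d) * g \<theta>)"
proof -
  have [measurable]: "g \<in> borel_measurable borel"
    using g by auto
  let ?S = "\<lambda>k. gauss_smooth g (1 / real (Suc k))"
  have [measurable]: "gauss_smooth g \<sigma> \<in> borel_measurable borel" for \<sigma>
    unfolding gauss_smooth_def by measurable
  have [measurable]: "fourier_inv_int g \<in> borel_measurable borel"
    unfolding fourier_inv_int_def by measurable
  define H where "H \<theta> = Re (fourier_inv_int g \<theta>)" for \<theta>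
  have [measurable]: "H \<in> borel_measurable borel"
    unfolding H_def by measurable
  have S: "(\<lambda>k. ?S k \<theta>) \<longlonglongrightarrow> H \<theta>" for \<theta>
    unfolding H_def using tendsto_Re[OF gauss_smooth_tendsto[OF g G, of \<theta>]] by simp
  have H0: "0 \<le> H \<theta>" for \<theta>
    by (rule LIMSEQ_le_const[OF S]) (auto intro!: gauss_smooth_nonneg g0)
  have Im0: "Im (fourier_inv_int g \<theta>) = 0" for \<theta>
    using tendsto_Im[OF gauss_smooth_tendsto[OF g G, of \<theta>]] by (simp add: LIMSEQ_const_iff)
  define N where "N = (LINT s|lborel. norm (fourier g s))"
  have S_bound: "\<bar>?S k \<theta>\<bar> \<le> N" for k \<theta>
  proof -
    have "\<bar>?S k \<theta>\<bar> = norm (CLINT s|lborel. fourier g s * iexp (s \<bullet> \<theta>) * complex_of_real (gauss ((1 / real (Suc k)) *\<^sub>R s)))"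
      by (subst fourier_gauss_smooth[OF g]) auto
    also have "\<dots> \<le> (LINT s|lborel. norm (fourier g s * iexp (s \<bullet> \<theta>) * complex_of_real (gauss ((1 / real (Suc k)) *\<^sub>R s))))"
      by (rule integral_norm_bound)
    also have "\<dots> \<le> N"
      unfolding N_def using integrable_norm[OF G]
      by (rule integral_mono')
        (auto simp: norm_mult gauss_nonneg gauss_le_1 intro!: mult_left_le)
    finally show ?thesis .
  qed
  have iB: "integrable lborel (indicator (box a b) :: real ^ 'd \<Rightarrow> real)" for a b
    by (auto intro!: integrable_real_indicator emeasure_bounded_finite)
  have dom: "integrable lborel (\<lambda>\<theta>. indicator (box a b) \<theta> * H \<theta>)"
      "(\<lambda>k. LINT \<theta>|lborel. indicator (box a b) \<theta> * ?S k \<theta>) \<longlonglongrightarrow> (LINT \<theta>|lborel. indicator (box a b) \<theta> * H \<theta>)" for a b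
  proof -
    have *: "AE \<theta> in lborel. (\<lambda>k. indicator (box a b) \<theta> * ?S k \<theta>) \<longlonglongrightarrow> indicator (box a b) \<theta> * H \<theta>"
      by (intro AE_I2 tendsto_intros S)
    have **: "integrable lborel (\<lambda>\<theta>::real ^ 'd. indicator (box a b) \<theta> * N)"
      using iB by simp
    have ***: "AE \<theta> in lborel. norm (indicator (box a b) \<theta> * ?S k \<theta>) \<le> indicator (box a b) \<theta> * N" for k
      using S_bound by (auto split: split_indicator)
    note D = **  * ***
    show "integrable lborel (\<lambda>\<theta>. indicator (box a b) \<theta> * H \<theta>)"
      by (rule integrable_dominated_convergence[OF _ _ D]) auto
    show "(\<lambda>k. LINT \<theta>|lborel. indicator (box a b) \<theta> * ?S k \<theta>) \<longlonglongrightarrow> (LINT \<theta>|lborel. indicator (box a b) \<theta> * H \<theta>)"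
      by (rule integral_dominated_convergence[OF _ _ D]) auto
  qed
  have "AE \<theta> in lborel. H \<theta> = (2 * pi) ^ CARD('d) * g \<theta>"
  proof (rule AE_eq_if_box_integrals_eq)
    show "(LINT x|lborel. indicator (box a b) x * H x) = (LINT x|lborel. indicator (box a b) x * ((2 * pi) ^ CARD('d) * g x))" for a b
      using LIMSEQ_unique[OF dom(2) box_integral_gauss_smooth_tendsto[OF g g0], of a b]
      by (subst mult.left_commute) (simp only: integral_mult_right_zero)
    show "integrable lborel (\<lambda>x. indicator (box a b) x * ((2 * pi) ^ CARD('d) * g x))" for a b
      by (rule Bochner_Integration.integrable_bound[OF integrable_mult_right[OF g, of "(2 * pi) ^ CARD('d)"]])
        (auto split: split_indicator)
  qed (auto simp: H0 g0 dom)
  then show ?thesis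
    by eventually_elim (auto simp: complex_eq_iff Im0 H_def)
qed

section \<open>The error of truncating the inversion integral to a cube\<close>

abbreviation cube :: "real \<Rightarrow> (real ^ 'd) set" where
  "cube R \<equiv> cbox (\<chi> j. - R) (\<chi> j. R)"

lemma mem_cube: "s \<in> cube R \<longleftrightarrow> (\<forall>j. \<bar>s $ j\<bar> \<le> R)"
  by (simp add: mem_box_cart abs_le_iff minus_le_iff conj_commute)

lemma measure_cube: "R \<ge> 0 \<Longrightarrow> measure lborel (cube R :: (real ^ 'd) set) = (2 * R) ^ CARD('d)"
proof -
  assume R: "R \<ge> 0"
  have "measure lborel (cube R :: (real ^ 'd) set) = (\<Prod>b\<in>(Basis :: (real ^ 'd) set). ((\<chi> j. R) - (\<chi> j. - R)) \<bullet> b)"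
    using R by (intro measure_lborel_cbox) (auto simp: Basis_vec_def inner_axis)
  also have "\<dots> = (\<Prod>b\<in>(Basis :: (real ^ 'd) set). 2 * R)"
    by (intro prod.cong refl) (auto simp: Basis_vec_def inner_axis)
  finally show ?thesis
    by simp
qed

lemma integrable_indicator_cube: "integrable lborel (indicator (cube R) :: real ^ 'd \<Rightarrow> real)"
  by (auto intro!: integrable_real_indicator emeasure_bounded_finite)

text \<open>A point outside the cube has a coordinate \<open>j\<close> with \<open>\<bar>s $ j\<bar> > R\<close>.  On that event the \<open>j\<close>-th factor may be
  cut off to \<open>\<bar>x\<bar> > R\<close>; summing over \<open>j\<close> and factoring each integral gives the bound.\<close>

lemma integral_prod_outside_cube_le:
  fixes h :: "real \<Rightarrow> real"
  assumes h: "integrable lborel h" and h0: "\<And>x. 0 \<le> h x"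
  shows "(LINT s|lborel. indicator (- cube R) s * (\<Prod>j\<in>UNIV. h ((s :: real ^ 'd) $ j))) \<le>
    CARD('d) * (LINT x|lborel. h x) ^ (CARD('d) - 1) * (LINT x|lborel. indicator {x. R < \<bar>x\<bar>} x * h x)"
proof -
  let ?T = "\<lambda>x. indicator {x. R < \<bar>x\<bar>} x * h x"
  have T: "integrable lborel ?T"
    using integrable_real_mult_indicator[OF _ h, of "{x. R < \<bar>x\<bar>}"] by (simp add: mult.commute)
  define e where "e j i = (if i = j then ?T else h)" for j i :: 'd
  have ei: "integrable lborel (e j i)" for j i
    using h T by (simp add: e_def)
  have e0: "0 \<le> e j i x" for j i x
    using h0 by (simp add: e_def)
  have ij: "integrable lborel (\<lambda>s :: real ^ 'd. \<Prod>i\<in>UNIV. e j i (s $ i))" for j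
    by (rule integrable_prod_coordinates[OF ei])
  have "(LINT s|lborel. indicator (- cube R) s * (\<Prod>j\<in>UNIV. h ((s :: real ^ 'd) $ j))) \<le>
      (LINT s|lborel. (\<Sum>j\<in>UNIV. \<Prod>i\<in>UNIV. e j i ((s :: real ^ 'd) $ i)))"
  proof (rule integral_mono')
    show "integrable lborel (\<lambda>s :: real ^ 'd. \<Sum>j\<in>UNIV. \<Prod>i\<in>UNIV. e j i (s $ i))"
      by (intro Bochner_Integration.integrable_sum ij)
    show "indicator (- cube R) s * (\<Prod>j\<in>UNIV. h (s $ j)) \<le> (\<Sum>j\<in>UNIV. \<Prod>i\<in>UNIV. e j i (s $ i))" for s :: "real ^ 'd"
    proof (cases "s \<in> cube R")
      case True
      then show ?thesis by (auto intro!: sum_nonneg prod_nonneg e0)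
    next
      case False
      then obtain j where j: "R < \<bar>s $ j\<bar>"
        by (auto simp: mem_cube not_le)
      then have "(\<Prod>j\<in>UNIV. h (s $ j)) = (\<Prod>i\<in>UNIV. e j i (s $ i))"
        by (intro prod.cong refl) (auto simp: e_def)
      also have "\<dots> \<le> (\<Sum>j\<in>UNIV. \<Prod>i\<in>UNIV. e j i (s $ i))"
        by (rule member_le_sum) (auto intro!: prod_nonneg e0)
      finally show ?thesis using False by simp
    qed
    show "0 \<le> (\<Sum>j\<in>UNIV. \<Prod>i\<in>UNIV. e j i (s $ i))" for s :: "real ^ 'd"
      by (intro sum_nonneg prod_nonneg) (auto simp: e0)
  qed
  also have "\<dots> = (\<Sum>j\<in>UNIV. \<Prod>i\<in>UNIV. LINT x|lborel. e j i x)"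
    by (simp add: ij integral_prod_coordinates[OF ei])
  also have "\<dots> = (\<Sum>j\<in>(UNIV :: 'd set). (LINT x|lborel. ?T x) * (LINT x|lborel. h x) ^ (CARD('d) - 1))"
  proof (intro sum.cong refl)
    fix j :: 'd
    have "(\<Prod>i\<in>UNIV. LINT x|lborel. e j i x) = (LINT x|lborel. e j j x) * (\<Prod>i\<in>UNIV - {j}. LINT x|lborel. e j i x)"
      by (rule prod.remove) auto
    also have "(\<Prod>i\<in>UNIV - {j}. LINT x|lborel. e j i x) = (\<Prod>i\<in>UNIV - {j}. LINT x|lborel. h x)"
      by (intro prod.cong refl) (auto simp: e_def)
    finally show "(\<Prod>i\<in>UNIV. LINT x|lborel. e j i x) = (LINT x|lborel. ?T x) * (LINT x|lborel. h x) ^ (CARD('d) - 1)"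
      by (simp add: e_def)
  qed
  finally show ?thesis
    by (simp add: mult_ac)
qed

text \<open>By inversion the error is the integral over the complement of the cube.  The exceptional null set is
  that of the inversion theorem, so one null set serves all \<open>R\<close>.\<close>

theorem truncated_inversion_error:
  fixes g :: "real ^ 'd \<Rightarrow> real" and h :: "real \<Rightarrow> real"
  assumes g: "integrable lborel g" and g0: "\<And>x. 0 \<le> g x"
    and h: "integrable lborel h" and h0: "\<And>x. 0 \<le> h x"
    and A: "A \<ge> 0" and bound: "\<And>s. norm (fourier g s) \<le> A * (\<Prod>j\<in>UNIV. h (s $ j))"
  shows "AE \<theta> in lborel. \<forall>R.
    \<bar>1 / (2 * pi) ^ CARD('d) * (LINT s:cube R|lborel. Re (fourier g s * iexp (s \<bullet> \<theta>))) - g \<theta>\<bar> \<le>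
    A * (CARD('d) * (LINT x|lborel. h x) ^ (CARD('d) - 1)) / (2 * pi) ^ CARD('d) *
      (LINT x|lborel. indicator {x. R < \<bar>x\<bar>} x * h x)"
proof -
  have [measurable]: "g \<in> borel_measurable borel"
    using g by auto
  have P: "integrable lborel (\<lambda>s :: real ^ 'd. A * (\<Prod>j\<in>UNIV. h (s $ j)))"
    using h by (intro integrable_mult_right integrable_prod_coordinates)
  have G: "integrable lborel (fourier g)"
    by (rule Bochner_Integration.integrable_bound[OF P]) (auto intro!: AE_I2 order.trans[OF bound])
  show ?thesis
    using fourier_inversion_AE[OF g g0 G]
  proof eventually_elim
    case (elim \<theta>)
    show ?case
    proof
      fix R
      let ?u = "\<lambda>s. fourier g s * iexp (s \<bullet> \<theta>)"
      have u: "integrable lborel ?u"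
        by (rule Bochner_Integration.integrable_bound[OF G]) (auto simp: norm_mult)
      have Reu: "integrable lborel (\<lambda>s. Re (?u s))"
        by (rule integrable_bounded_linear[OF bounded_linear_Re u])
      have inv: "(LINT s|lborel. Re (?u s)) = (2 * pi) ^ CARD('d) * g \<theta>"
        by (simp only: integral_Re[OF u] fourier_inv_int_def[symmetric] elim Re_complex_of_real)
      have i1: "integrable lborel (\<lambda>s. indicator (cube R) s *\<^sub>R Re (?u s))"
        by (rule integrable_mult_indicator[OF _ Reu]) auto
      have i2: "integrable lborel (\<lambda>s. indicator (- cube R) s *\<^sub>R Re (?u s))"
        by (rule integrable_mult_indicator[OF _ Reu]) auto
      have "(LINT s|lborel. Re (?u s)) =
          (LINT s|lborel. indicator (cube R) s *\<^sub>R Re (?u s) + indicator (- cube R) s *\<^sub>R Re (?u s))"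
        by (intro Bochner_Integration.integral_cong refl) (simp split: split_indicator)
      also have "\<dots> = (LINT s:cube R|lborel. Re (?u s)) + (LINT s|lborel. indicator (- cube R) s *\<^sub>R Re (?u s))"
        unfolding set_lebesgue_integral_def by (rule Bochner_Integration.integral_add[OF i1 i2])
      finally have split: "(LINT s:cube R|lborel. Re (?u s)) - (2 * pi) ^ CARD('d) * g \<theta> =
          - (LINT s|lborel. indicator (- cube R) s *\<^sub>R Re (?u s))"
        using inv by simp
      have "\<bar>LINT s|lborel. indicator (- cube R) s *\<^sub>R Re (?u s)\<bar> \<le>
          (LINT s|lborel. \<bar>indicator (- cube R) s *\<^sub>R Re (?u s)\<bar>)"
        by (rule integral_abs_bound)
      also have "\<dots> \<le> (LINT s|lborel. A * (indicator (- cube R) s * (\<Prod>j\<in>UNIV. h ((s :: real ^ 'd) $ j))))"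
      proof (rule integral_mono)
        show "integrable lborel (\<lambda>s. \<bar>indicator (- cube R) s *\<^sub>R Re (?u s)\<bar>)"
          using i2 by auto
        have "integrable lborel (\<lambda>s :: real ^ 'd. indicator (- cube R) s *\<^sub>R (A * (\<Prod>j\<in>UNIV. h (s $ j))))"
          by (rule integrable_mult_indicator[OF _ P]) auto
        then show "integrable lborel (\<lambda>s :: real ^ 'd. A * (indicator (- cube R) s * (\<Prod>j\<in>UNIV. h (s $ j))))"
          by (simp add: mult_ac)
        show "\<bar>indicator (- cube R) s *\<^sub>R Re (?u s)\<bar> \<le> A * (indicator (- cube R) s * (\<Prod>j\<in>UNIV. h (s $ j)))" for s
          using order.trans[OF abs_Re_le_cmod[of "?u s"], of "A * (\<Prod>j\<in>UNIV. h (s $ j))"] bound[of s]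
          by (auto simp: norm_mult split: split_indicator)
      qed
      also have "\<dots> = A * (LINT s|lborel. indicator (- cube R) s * (\<Prod>j\<in>UNIV. h ((s :: real ^ 'd) $ j)))"
        by (rule integral_mult_right_zero)
      finally have E: "\<bar>(LINT s:cube R|lborel. Re (?u s)) - (2 * pi) ^ CARD('d) * g \<theta>\<bar> \<le> \<dots>"
        unfolding split by simp
      show "\<bar>1 / (2 * pi) ^ CARD('d) * (LINT s:cube R|lborel. Re (?u s)) - g \<theta>\<bar> \<le>
          A * (CARD('d) * (LINT x|lborel. h x) ^ (CARD('d) - 1)) / (2 * pi) ^ CARD('d) *
            (LINT x|lborel. indicator {x. R < \<bar>x\<bar>} x * h x)"
      proof -
        let ?c = "(2 * pi) ^ CARD('d)"
        have "\<bar>1 / ?c * (LINT s:cube R|lborel. Re (?u s)) - g \<theta>\<bar> = \<bar>(LINT s:cube R|lborel. Re (?u s)) - ?c * g \<theta>\<bar> / ?c"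
          by (subst abs_div_pos) (auto simp: diff_divide_distrib)
        also have "\<dots> \<le> A * (CARD('d) * (LINT x|lborel. h x) ^ (CARD('d) - 1) *
            (LINT x|lborel. indicator {x. R < \<bar>x\<bar>} x * h x)) / ?c"
          using A by (intro divide_right_mono order.trans[OF E] mult_left_mono integral_prod_outside_cube_le h h0) auto
        finally show ?thesis
          by (simp add: mult_ac)
      qed
    qed
  qed
qed

section \<open>Tail integrals of the two smoothness envelopes\<close>

text \<open>\<open>F\<close> is an antiderivative of \<open>- D\<close> that vanishes at infinity, so \<open>F R\<close> is the integral of the
  majorant \<open>D\<close> over \<open>[R, \<infinity>)\<close>; symmetry doubles it.\<close>

lemma
  fixes h D F :: "real \<Rightarrow> real"
  assumes hm [measurable]: "h \<in> borel_measurable borel" and h0: "\<And>x. 0 \<le> h x" and even: "\<And>x. h (- x) = h x"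
    and Dm [measurable]: "D \<in> borel_measurable borel"
    and F: "\<And>x. R \<le> x \<Longrightarrow> (F has_real_derivative - D x) (at x)" "(F \<longlongrightarrow> 0) at_top"
    and hD: "\<And>x. R \<le> x \<Longrightarrow> h x \<le> D x"
  shows even_tail_integrable: "integrable lborel (\<lambda>x. indicator {x. R < \<bar>x\<bar>} x * h x)"
    and even_tail_integral_le: "(LINT x|lborel. indicator {x. R < \<bar>x\<bar>} x * h x) \<le> 2 * F R"
proof -
  have D0: "0 \<le> D x" if "R \<le> x" for x
    using hD[OF that] h0[of x] by simp
  let ?d = "\<lambda>x. ennreal (D x) * indicator {R..} x"
  have half: "(\<integral>\<^sup>+x. ?d x \<partial>lborel) = ennreal (F R)"
  proof -
    have "(\<integral>\<^sup>+x. ?d x \<partial>lborel) = ennreal (- 0 - (- F R))"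
      by (rule nn_integral_FTC_atLeast[where F = "\<lambda>x. - F x"])
        (use F D0 in \<open>auto intro!: derivative_eq_intros tendsto_minus simp del: minus_zero\<close>)
    then show ?thesis by simp
  qed
  have F0: "0 \<le> F R"
  proof -
    have "F x \<le> F R" if "x \<ge> R" for x
      using that by (rule DERIV_nonpos_imp_nonincreasing) (use F D0 in force)
    then have "eventually (\<lambda>x. F x \<le> F R) at_top"
      by (auto intro: eventually_mono[OF eventually_ge_at_top[of R]])
    with F(2) show ?thesis
      by (rule tendsto_upperbound) simp
  qed
  have "(\<integral>\<^sup>+x. ennreal (indicator {x. R < \<bar>x\<bar>} x * h x) \<partial>lborel) \<le> (\<integral>\<^sup>+x. ?d x + ?d (- x) \<partial>lborel)"
  proof (rule nn_integral_mono)
    fix x :: real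
    consider "R < x" | "R < - x" | "\<not> R < \<bar>x\<bar>" by linarith
    then show "ennreal (indicator {x. R < \<bar>x\<bar>} x * h x) \<le> ?d x + ?d (- x)"
    proof cases
      case 1
      then have "ennreal (indicator {x. R < \<bar>x\<bar>} x * h x) \<le> ?d x"
        using hD[of x] h0[of x] by (auto intro!: ennreal_leI split: split_indicator)
      then show ?thesis by (simp add: add_increasing2)
    next
      case 2
      then have "ennreal (indicator {x. R < \<bar>x\<bar>} x * h x) \<le> ?d (- x)"
        using hD[of "- x"] h0[of x] even[of x] by (auto intro!: ennreal_leI split: split_indicator)
      then show ?thesis by (simp add: add_increasing)
    qed simp
  qed
  also have "\<dots> = (\<integral>\<^sup>+x. ?d x \<partial>lborel) + (\<integral>\<^sup>+x. ?d (- x) \<partial>lborel)"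
    by (rule nn_integral_add) measurable
  also have "(\<integral>\<^sup>+x. ?d (- x) \<partial>lborel) = (\<integral>\<^sup>+x. ?d x \<partial>distr lborel borel uminus)"
    by (subst nn_integral_distr) auto
  also have "\<dots> = (\<integral>\<^sup>+x. ?d x \<partial>lborel)"
    by (simp only: lborel_distr_uminus)
  finally have le: "(\<integral>\<^sup>+x. ennreal (indicator {x. R < \<bar>x\<bar>} x * h x) \<partial>lborel) \<le> ennreal (2 * F R)"
    using F0 by (simp add: half flip: ennreal_plus)
  have nn: "0 \<le> indicator {x. R < \<bar>x\<bar>} x * h x" for x
    using h0 by simp
  show "integrable lborel (\<lambda>x. indicator {x. R < \<bar>x\<bar>} x * h x)"
    using le nn by (intro integrableI_bounded) (auto simp: top.not_eq_extremum intro: le_less_trans)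
  show "(LINT x|lborel. indicator {x. R < \<bar>x\<bar>} x * h x) \<le> 2 * F R"
    using le nn F0 by (subst integral_eq_nn_integral) (auto intro!: enn2real_leI)
qed

lemma integrable_if_tail_integrable:
  fixes h :: "real \<Rightarrow> real"
  assumes [measurable]: "h \<in> borel_measurable borel" and h: "\<And>x. 0 \<le> h x" "\<And>x. h x \<le> 1"
    and tail: "integrable lborel (\<lambda>x. indicator {x. R < \<bar>x\<bar>} x * h x)"
  shows "integrable lborel h"
proof -
  have "integrable lborel (\<lambda>x. indicator {-R..R} x + indicator {x. R < \<bar>x\<bar>} x * h x)"
    by (intro Bochner_Integration.integrable_add tail integrable_real_indicator) (auto simp: emeasure_lborel_Icc_eq)
  then show ?thesis
    by (rule Bochner_Integration.integrable_bound) (use h in \<open>auto simp: abs_le_iff split: split_indicator\<close>)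
qed

text \<open>The first term \<open>x powr (1 - \<alpha>) * exp (- c * x powr \<alpha>) / (c * \<alpha>)\<close> of the asymptotic expansion of
  the tail, doubled, decreases at the rate
  \<open>2 / (c * \<alpha>) * (c * \<alpha> - (1 - \<alpha>) * x powr (- \<alpha>)) * exp (- c * x powr \<alpha>)\<close>.  For large \<open>x\<close> the middle
  factor is at least \<open>c * \<alpha> / 2\<close>, whatever the sign of \<open>1 - \<alpha>\<close>, so this rate dominates
  the envelope.\<close>

lemma supersmooth_tail:
  fixes \<alpha> c :: real
  assumes \<alpha>: "\<alpha> > 0" and c: "c > 0"
  defines "h \<equiv> \<lambda>x. exp (- c * \<bar>x\<bar> powr \<alpha>)"
  shows "integrable lborel h"
    and "\<And>R. R \<ge> max 1 ((2 / (c * \<alpha>)) powr (1 / \<alpha>)) \<Longrightarrow>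
      (LINT x|lborel. indicator {x. R < \<bar>x\<bar>} x * h x) \<le> 4 / (c * \<alpha>) * (R powr max (1 - \<alpha>) 0 * exp (- c * R powr \<alpha>))"
proof -
  define F where "F x = 2 / (c * \<alpha>) * (x powr (1 - \<alpha>) * exp (- c * x powr \<alpha>))" for x
  define D where "D x = 2 / (c * \<alpha>) * ((c * \<alpha> - (1 - \<alpha>) * x powr (- \<alpha>)) * exp (- c * x powr \<alpha>))" for x
  \<comment> \<open>beyond \<open>C'\<close>, \<open>x powr (- \<alpha>) \<le> c * \<alpha> / 2\<close>; that \<open>C' \<ge> 1\<close> makes \<open>R powr e\<close> increasing in \<open>e\<close>\<close>
  define C' where "C' = max 1 ((2 / (c * \<alpha>)) powr (1 / \<alpha>))"
  have [measurable]: "h \<in> borel_measurable borel" "D \<in> borel_measurable borel"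
    unfolding h_def D_def by measurable
  have F': "(F has_real_derivative - D x) (at x)" if "0 < x" for x
  proof -
    have "x powr (1 - \<alpha>) * x powr (\<alpha> - 1) = 1"
      using that by (simp flip: powr_add)
    then show ?thesis
      unfolding F_def D_def using that \<alpha> c
      by (auto intro!: derivative_eq_intros simp: field_simps)
  qed
  have Flim: "(F \<longlongrightarrow> 0) at_top"
    unfolding F_def using \<alpha> c by real_asymp
  have hD: "h x \<le> D x" if x: "C' \<le> x" for x
  proof -
    have "x \<ge> 1" "x \<ge> (2 / (c * \<alpha>)) powr (1 / \<alpha>)"
      using x by (auto simp: C'_def)
    then have "x powr \<alpha> \<ge> ((2 / (c * \<alpha>)) powr (1 / \<alpha>)) powr \<alpha>"
      using \<alpha> by (intro powr_mono2) auto
    then have "x powr \<alpha> \<ge> 2 / (c * \<alpha>)"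
      using \<alpha> c by (simp add: powr_powr)
    then have "x powr (- \<alpha>) \<le> c * \<alpha> / 2"
      using \<alpha> c \<open>x \<ge> 1\<close> by (simp add: powr_minus field_simps)
    moreover have "(1 - \<alpha>) * x powr (- \<alpha>) \<le> 1 * x powr (- \<alpha>)"
      using \<alpha> by (intro mult_right_mono) auto
    ultimately have "c * \<alpha> / 2 \<le> c * \<alpha> - (1 - \<alpha>) * x powr (- \<alpha>)"
      by linarith
    then have "2 / (c * \<alpha>) * (c * \<alpha> / 2 * exp (- c * x powr \<alpha>)) \<le> D x"
      unfolding D_def using \<alpha> c by (intro mult_left_mono mult_right_mono) auto
    then show ?thesis
      using \<alpha> c \<open>x \<ge> 1\<close> by (simp add: h_def)
  qed
  have pos: "0 < x" if "C' \<le> x" for x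
    using that by (simp add: C'_def)
  have tail: "integrable lborel (\<lambda>x. indicator {x. R < \<bar>x\<bar>} x * h x)"
      "(LINT x|lborel. indicator {x. R < \<bar>x\<bar>} x * h x) \<le> 2 * F R" if "C' \<le> R" for R
    using that
    by (auto intro!: even_tail_integrable[where D = D and F = F] even_tail_integral_le[where D = D and F = F] F' Flim hD pos)
      (auto simp: h_def)
  show "integrable lborel h"
    by (rule integrable_if_tail_integrable[OF _ _ _ tail(1)[OF order.refl]]) (use c in \<open>auto simp: h_def\<close>)
  fix R assume R: "R \<ge> max 1 ((2 / (c * \<alpha>)) powr (1 / \<alpha>))"
  then have "2 * F R = 4 / (c * \<alpha>) * (R powr (1 - \<alpha>) * exp (- c * R powr \<alpha>))"
    by (simp add: F_def)
  also have "\<dots> \<le> 4 / (c * \<alpha>) * (R powr max (1 - \<alpha>) 0 * exp (- c * R powr \<alpha>))"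
    using R \<alpha> c by (intro mult_left_mono mult_right_mono powr_mono) auto
  finally show "(LINT x|lborel. indicator {x. R < \<bar>x\<bar>} x * h x) \<le> 4 / (c * \<alpha>) * (R powr max (1 - \<alpha>) 0 * exp (- c * R powr \<alpha>))"
    using tail(2)[of R] R by (simp add: C'_def)
qed

lemma ordinary_smooth_tail:
  fixes \<beta> :: real
  assumes \<beta>: "\<beta> > 1"
  defines "h \<equiv> \<lambda>x. 1 / (1 + \<bar>x\<bar> powr \<beta>)"
  shows "integrable lborel h"
    and "\<And>R. R > 0 \<Longrightarrow>
      (LINT x|lborel. indicator {x. R < \<bar>x\<bar>} x * h x) \<le> 2 / (\<beta> - 1) / R powr (\<beta> - 1)"
proof -
  define F where "F x = x powr (1 - \<beta>) / (\<beta> - 1)" for x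
  define D where "D x = x powr (- \<beta>)" for x :: real
  have [measurable]: "h \<in> borel_measurable borel" "D \<in> borel_measurable borel"
    unfolding h_def D_def by measurable
  have F': "(F has_real_derivative - D x) (at x)" if "0 < x" for x
  proof -
    have "(1 - \<beta>) * x powr (1 - \<beta> - 1) / (\<beta> - 1) = - D x"
      using \<beta> by (simp add: D_def divide_eq_eq algebra_simps)
    with DERIV_cdivide[OF has_real_derivative_powr[OF that, of "1 - \<beta>"], of "\<beta> - 1"]
    show ?thesis
      by (simp only: F_def[abs_def])
  qed
  have Flim: "(F \<longlongrightarrow> 0) at_top"
    unfolding F_def using \<beta> by real_asymp
  have hD: "h x \<le> D x" if "0 < x" for x
    using that by (simp add: h_def D_def powr_minus_divide divide_left_mono add_pos_pos)
  have tail: "integrable lborel (\<lambda>x. indicator {x. R < \<bar>x\<bar>} x * h x)"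
      "(LINT x|lborel. indicator {x. R < \<bar>x\<bar>} x * h x) \<le> 2 * F R" if "0 < R" for R
    using that
    by (auto intro!: even_tail_integrable[where D = D and F = F] even_tail_integral_le[where D = D and F = F] F' Flim hD)
      (auto simp: h_def add_pos_nonneg)
  show "integrable lborel h"
    by (rule integrable_if_tail_integrable[OF _ _ _ tail(1)[of 1]]) (auto simp: h_def add_pos_nonneg)
  fix R :: real assume R: "R > 0"
  have "R powr (1 - \<beta>) = 1 / R powr (\<beta> - 1)"
    using powr_minus_divide[of R "\<beta> - 1"] by simp
  then show "(LINT x|lborel. indicator {x. R < \<bar>x\<bar>} x * h x) \<le> 2 / (\<beta> - 1) / R powr (\<beta> - 1)"
    using tail(2)[OF R] by (simp add: F_def mult.commute)
qed

section \<open>Variance of sums of independent bounded variables\<close>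

lemma (in prob_space) variance_add_indep:
  fixes X Y :: "'a \<Rightarrow> real"
  assumes ind: "indep_var borel X borel Y"
    and X: "integrable M X" "integrable M (\<lambda>x. (X x)\<^sup>2)" and Y: "integrable M Y" "integrable M (\<lambda>x. (Y x)\<^sup>2)"
  shows "variance (\<lambda>x. X x + Y x) = variance X + variance Y"
proof -
  have XY: "integrable M (\<lambda>x. X x * Y x)"
    by (rule indep_var_integrable[OF ind X(1) Y(1)])
  have sq: "(X x + Y x)\<^sup>2 = (X x)\<^sup>2 + (Y x)\<^sup>2 + 2 * (X x * Y x)" for x
    by (simp add: power2_sum)
  have "variance (\<lambda>x. X x + Y x) = expectation (\<lambda>x. (X x + Y x)\<^sup>2) - (expectation (\<lambda>x. X x + Y x))\<^sup>2"
    using X Y XY by (intro variance_eq) (auto simp: sq)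
  also have "\<dots> = expectation (\<lambda>x. (X x)\<^sup>2) + expectation (\<lambda>x. (Y x)\<^sup>2) + 2 * (expectation X * expectation Y) - (expectation X + expectation Y)\<^sup>2"
    using X Y XY indep_var_lebesgue_integral[OF ind X(1) Y(1)] by (simp add: sq)
  also have "\<dots> = variance X + variance Y"
    using X Y by (simp add: variance_eq power2_sum)
  finally show ?thesis .
qed

text \<open>Boundedness supplies all integrability; each summand has variance at most \<open>K\<^sup>2\<close>.\<close>

lemma (in prob_space) variance_sum_indep_le:
  fixes Z :: "'i \<Rightarrow> 'a \<Rightarrow> real" and K :: real
  assumes "finite I" "indep_vars (\<lambda>_. borel) Z I" and "\<And>i x. i \<in> I \<Longrightarrow> \<bar>Z i x\<bar> \<le> K"
  shows "variance (\<lambda>x. \<Sum>i\<in>I. Z i x) \<le> card I * K\<^sup>2"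
  using assms
proof (induction I rule: finite_induct)
  case empty
  then show ?case by simp
next
  case (insert i I)
  have m [measurable]: "random_variable borel (Z j)" if "j \<in> insert i I" for j
    using insert.prems(1) that unfolding indep_vars_def2 by auto
  have b: "\<bar>\<Sum>j\<in>I. Z j x\<bar> \<le> card I * K" for x
    using insert.prems(2) by (intro order.trans[OF sum_abs] sum_bounded_above) auto
  have sq: "(a :: real)\<^sup>2 \<le> c\<^sup>2" if "\<bar>a\<bar> \<le> c" for a c
    using that abs_le_square_iff by force
  have i1: "integrable M (Z i)" "integrable M (\<lambda>x. (Z i x)\<^sup>2)"
    using insert.prems(2)[of i] m[of i] sq[of "Z i _" K]
    by (auto intro: integrable_const_bound[where B = K] integrable_const_bound[where B = "K\<^sup>2"])
  have [measurable]: "random_variable borel (\<lambda>x. \<Sum>j\<in>I. Z j x)"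
    using m by auto
  have i2: "integrable M (\<lambda>x. \<Sum>j\<in>I. Z j x)" "integrable M (\<lambda>x. (\<Sum>j\<in>I. Z j x)\<^sup>2)"
    using b sq[OF b]
    by (auto intro: integrable_const_bound[where B = "card I * K"] integrable_const_bound[where B = "(card I * K)\<^sup>2"])
  have "variance (\<lambda>x. \<Sum>i\<in>insert i I. Z i x) = variance (Z i) + variance (\<lambda>x. \<Sum>j\<in>I. Z j x)"
    using insert.hyps variance_add_indep[OF indep_vars_sum[OF insert.hyps insert.prems(1)] i1 i2] by simp
  also have "variance (Z i) \<le> K\<^sup>2"
  proof -
    have "variance (Z i) \<le> expectation (\<lambda>x. (Z i x)\<^sup>2)"
      using i1 by (simp add: variance_eq)
    also have "\<dots> \<le> expectation (\<lambda>x. K\<^sup>2)"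
      using i1 insert.prems(2)[of i] by (intro integral_mono sq) auto
    finally show ?thesis by (simp add: prob_space)
  qed
  also have "variance (\<lambda>x. \<Sum>j\<in>I. Z j x) \<le> card I * K\<^sup>2"
    using insert.prems indep_vars_subset[OF insert.prems(1)] by (intro insert.IH) auto
  finally show ?case
    using insert.hyps by (simp add: algebra_simps)
qed

section \<open>Mixtures are convolutions\<close>

lemma integrable_convolution_kernel:
  fixes f g :: "real ^ 'd \<Rightarrow> real"
  assumes f: "integrable lborel f" and g: "integrable lborel g"
  shows "integrable (lborel \<Otimes>\<^sub>M lborel) (\<lambda>(\<theta>, x). f (x - \<theta>) * g \<theta>)"
proof -
  have [measurable]: "f \<in> borel_measurable borel" "g \<in> borel_measurable borel"
    using f g by auto
  have f': "integrable lborel (\<lambda>x. f (x - \<theta>))" for \<theta>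
    using lborel_integrable_affine[of f 1 "- \<theta>"] f by simp
  have nf: "(LINT x|lborel. \<bar>f (x - \<theta>)\<bar>) = (LINT x|lborel. \<bar>f x\<bar>)" for \<theta>
    using lborel_integral_affine[of "\<lambda>x. \<bar>f x\<bar>" 1 "- \<theta>"] by simp
  show ?thesis
    by (rule lborel_pair.Fubini_integrable) (use f' g in \<open>auto simp: abs_mult nf\<close>)
qed

text \<open>As \<open>g\<close> vanishes off \<open>\<Theta>\<close>, the indicator of \<open>\<Theta>\<close> does not change the integrand, at any point.\<close>

lemma mixture_pdf_eq:
  assumes "\<And>\<theta>. \<theta> \<notin> \<Theta> \<Longrightarrow> g \<theta> = 0"
  shows "mixture_pdf \<Theta> f g x = (LINT \<theta>|lborel. f (x - \<theta>) * g \<theta>)"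
  unfolding mixture_pdf_def set_lebesgue_integral_def
  using assms by (intro Bochner_Integration.integral_cong refl) (auto split: split_indicator)

text \<open>The convolution theorem: after Fubini, the substitution \<open>x = \<theta> + y\<close> splits \<open>exp (- i s \<bullet> x)\<close> into
  one factor for each of \<open>f\<close> and \<open>g\<close>.\<close>

lemma
  fixes f g :: "real ^ 'd \<Rightarrow> real"
  assumes f: "integrable lborel f" and g: "integrable lborel g" and gT: "\<And>\<theta>. \<theta> \<notin> \<Theta> \<Longrightarrow> g \<theta> = 0"
  shows integrable_mixture_pdf: "integrable lborel (mixture_pdf \<Theta> f g)"
    and fourier_mixture_pdf: "fourier (mixture_pdf \<Theta> f g) s = fourier f s * fourier g s"
proof -
  have [measurable]: "f \<in> borel_measurable borel" "g \<in> borel_measurable borel"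
    using f g by auto
  have p: "mixture_pdf \<Theta> f g = (\<lambda>x. LINT \<theta>|lborel. f (x - \<theta>) * g \<theta>)"
    by (intro ext mixture_pdf_eq gT)
  note K = integrable_convolution_kernel[OF f g]
  show "integrable lborel (mixture_pdf \<Theta> f g)"
    unfolding p using lborel_pair.integrable_snd[OF K] by simp
  define k where "k \<theta> x = complex_of_real (f (x - \<theta>) * g \<theta>) * iexp (- (s \<bullet> x))" for \<theta> x
  have k: "integrable (lborel \<Otimes>\<^sub>M lborel) (\<lambda>(\<theta>, x). k \<theta> x)"
    by (rule Bochner_Integration.integrable_bound[OF K]) (auto simp: k_def norm_mult abs_mult split_beta)
  have "fourier (mixture_pdf \<Theta> f g) s = (CLINT x|lborel. CLINT \<theta>|lborel. k \<theta> x)"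
    unfolding fourier_eq_iexp p k_def
    by (intro Bochner_Integration.integral_cong refl) (simp only: integral_mult_left_zero integral_complex_of_real)
  also have "\<dots> = (CLINT \<theta>|lborel. CLINT x|lborel. k \<theta> x)"
    by (rule lborel_pair.Fubini_integral[OF k])
  also have "\<dots> = (CLINT \<theta>|lborel. fourier f s * (complex_of_real (g \<theta>) * iexp (- (s \<bullet> \<theta>))))"
  proof (intro Bochner_Integration.integral_cong refl)
    fix \<theta>
    have "(CLINT x|lborel. k \<theta> x) = (CLINT x|lborel. k \<theta> (\<theta> + 1 *\<^sub>R x))"
      by (subst lborel_integral_affine[where c = 1 and t = \<theta>]) (auto simp: k_def[abs_def])
    also have "\<dots> = (CLINT x|lborel. (complex_of_real (f x) * iexp (- (s \<bullet> x))) * (complex_of_real (g \<theta>) * iexp (- (s \<bullet> \<theta>))))"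
      by (intro Bochner_Integration.integral_cong refl)
        (simp add: k_def inner_add_right distrib_left exp_add exp_diff exp_minus field_simps)
    also have "\<dots> = fourier f s * (complex_of_real (g \<theta>) * iexp (- (s \<bullet> \<theta>)))"
      unfolding fourier_eq_iexp by (rule integral_mult_left_zero)
    finally show "(CLINT x|lborel. k \<theta> x) = fourier f s * (complex_of_real (g \<theta>) * iexp (- (s \<bullet> \<theta>)))" .
  qed
  also have "\<dots> = fourier f s * fourier g s"
    unfolding fourier_eq_iexp[of g] by (rule integral_mult_right_zero)
  finally show "fourier (mixture_pdf \<Theta> f g) s = fourier f s * fourier g s" .
qed

section \<open>Mean and variance of the deconvolution estimator\<close>

text \<open>The contribution of a single observation \<open>x\<close>, before averaging and the factor \<open>(2 \<pi>)\<^sup>-\<^sup>d\<close>.\<close>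

definition deconv_kernel :: "(real ^ 'd \<Rightarrow> real) \<Rightarrow> real \<Rightarrow> real ^ 'd \<Rightarrow> real ^ 'd \<Rightarrow> real" where
  "deconv_kernel f R \<theta> x = (LINT s:cube R|lborel. cos (s \<bullet> (\<theta> - x)) / Re (fourier f s))"

lemma deconv_estimator_eq_sum:
  "deconv_estimator f n R x \<theta> =
    (\<Sum>i=1..n. deconv_kernel f R \<theta> (x i) / (real n * (2 * pi) ^ CARD('d)))" for f :: "real ^ 'd \<Rightarrow> real"
  by (simp add: deconv_estimator_def deconv_kernel_def sum_divide_distrib)

lemma deconv_kernel_measurable [measurable]:
  assumes [measurable]: "f \<in> borel_measurable borel"
  shows "deconv_kernel f R \<theta> \<in> borel_measurable borel"
  unfolding deconv_kernel_def set_lebesgue_integral_def by measurable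

text \<open>Each factor of the lower bound decreases in \<open>\<bar>s $ j\<bar>\<close>, so on the cube the bound is smallest at the
  corners.  Taking real parts loses nothing, as the transform of a symmetric function is real.\<close>

lemma inverse_fourier_bound_on_cube:
  fixes f :: "real ^ 'd \<Rightarrow> real"
  assumes f: "f \<in> borel_measurable borel" and sym: "\<And>x. f x = f (- x)"
    and c0: "c0 > 0" and low: "\<And>s. norm (fourier f s) \<ge> c0 * (\<Prod>j\<in>UNIV. 1 / (1 + \<bar>s $ j\<bar> powr \<beta>))"
    and \<beta>: "\<beta> > 0" and s: "s \<in> cube R"
  shows "1 / \<bar>Re (fourier f s)\<bar> \<le> (1 + R powr \<beta>) ^ CARD('d) / c0"
proof -
  have p: "0 < (1 + R powr \<beta>) ^ CARD('d)"
    by (intro zero_less_power) (simp add: add_pos_nonneg)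
  have "(1 / (1 + R powr \<beta>)) ^ CARD('d) = (\<Prod>j\<in>(UNIV :: 'd set). 1 / (1 + R powr \<beta>))"
    by simp
  also have "\<dots> \<le> (\<Prod>j\<in>UNIV. 1 / (1 + \<bar>s $ j\<bar> powr \<beta>))"
    using s \<beta> by (intro prod_mono) (auto simp: mem_cube intro!: divide_left_mono powr_mono2 add_pos_nonneg mult_pos_pos)
  finally have "c0 * (1 / (1 + R powr \<beta>)) ^ CARD('d) \<le> norm (fourier f s)"
    using c0 low[of s] by (meson mult_left_mono less_imp_le order.trans)
  also have "norm (fourier f s) = \<bar>Re (fourier f s)\<bar>"
    by (subst fourier_real_if_symmetric[OF f sym, symmetric]) simp
  finally have *: "c0 / (1 + R powr \<beta>) ^ CARD('d) \<le> \<bar>Re (fourier f s)\<bar>"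
    by (simp add: power_one_over)
  have "1 / \<bar>Re (fourier f s)\<bar> \<le> 1 / (c0 / (1 + R powr \<beta>) ^ CARD('d))"
    using * c0 p by (intro frac_le) auto
  then show ?thesis by simp
qed

lemma deconv_kernel_bound:
  fixes f :: "real ^ 'd \<Rightarrow> real"
  assumes f [measurable]: "f \<in> borel_measurable borel"
    and Q: "\<And>s. s \<in> cube R \<Longrightarrow> 1 / \<bar>Re (fourier f s)\<bar> \<le> Q" and R: "R \<ge> 0"
  shows "\<bar>deconv_kernel f R \<theta> x\<bar> \<le> Q * (2 * R) ^ CARD('d)"
proof -
  have b: "\<bar>indicator (cube R) s * (cos (s \<bullet> (\<theta> - x)) / Re (fourier f s))\<bar> \<le> Q * indicator (cube R) s" for s
  proof -
    have "\<bar>cos (s \<bullet> (\<theta> - x)) / Re (fourier f s)\<bar> \<le> 1 / \<bar>Re (fourier f s)\<bar>"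
      by (simp add: abs_divide divide_right_mono)
    then show ?thesis
      using Q[of s] by (auto split: split_indicator)
  qed
  have i: "integrable lborel (\<lambda>s. indicator (cube R) s * (cos (s \<bullet> (\<theta> - x)) / Re (fourier f s)))"
    by (rule Bochner_Integration.integrable_bound[OF integrable_mult_right[OF integrable_indicator_cube, of Q R]])
      (simp, intro AE_I2, unfold real_norm_def, rule order.trans[OF b abs_ge_self])
  have "\<bar>deconv_kernel f R \<theta> x\<bar> \<le> (LINT s|lborel. Q * indicator (cube R) (s :: real ^ 'd))"
    unfolding deconv_kernel_def set_lebesgue_integral_def real_scaleR_def
    by (rule integral_abs_bound_integral[OF i integrable_mult_right[OF integrable_indicator_cube] b])
  then show ?thesis
    using R by (simp add: measure_cube)
qed

text \<open>The heart of deconvolution: after Fubini the inner integral is the real part of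
  \<open>fourier p s * exp (i s \<bullet> \<theta>)\<close>, \<open>p\<close> being the mixture density.  It contains the real factor
  \<open>fourier f s\<close>, which cancels the denominator of the kernel.\<close>

lemma integral_deconv_kernel:
  fixes f g :: "real ^ 'd \<Rightarrow> real"
  assumes f: "integrable lborel f" and sym: "\<And>x. f x = f (- x)"
    and g: "integrable lborel g" and gT: "\<And>\<theta>. \<theta> \<notin> \<Theta> \<Longrightarrow> g \<theta> = 0"
    and nz: "\<And>s. fourier f s \<noteq> 0"
    and Q: "\<And>s. s \<in> cube R \<Longrightarrow> 1 / \<bar>Re (fourier f s)\<bar> \<le> Q"
  shows "(LINT x|lborel. mixture_pdf \<Theta> f g x * deconv_kernel f R \<theta> x) =
    (LINT s:cube R|lborel. Re (fourier g s * iexp (s \<bullet> \<theta>)))"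
proof -
  have fm [measurable]: "f \<in> borel_measurable borel"
    using f by auto
  let ?p = "mixture_pdf \<Theta> f g"
  have p: "integrable lborel ?p"
    by (rule integrable_mixture_pdf[OF f g gT])
  then have [measurable]: "?p \<in> borel_measurable borel"
    by auto
  define k where "k x s = ?p x * (indicator (cube R) s * (cos (s \<bullet> (\<theta> - x)) / Re (fourier f s)))" for x s
  have b: "\<bar>k x s\<bar> \<le> \<bar>?p x * (Q * indicator (cube R) s)\<bar>" for x s
  proof -
    have "\<bar>cos (s \<bullet> (\<theta> - x)) / Re (fourier f s)\<bar> \<le> 1 / \<bar>Re (fourier f s)\<bar>"
      by (simp add: abs_divide divide_right_mono)
    also have "\<dots> \<le> \<bar>Q\<bar>" if "s \<in> cube R"
      using Q[OF that] by simp
    finally have "\<bar>indicator (cube R) s * (cos (s \<bullet> (\<theta> - x)) / Re (fourier f s))\<bar> \<le> \<bar>Q * indicator (cube R) s\<bar>"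
      by (cases "s \<in> cube R") simp_all
    then show ?thesis
      unfolding k_def abs_mult[of "?p x"] by (rule mult_left_mono) simp
  qed
  have k: "integrable (lborel \<Otimes>\<^sub>M lborel) (\<lambda>(x, s). k x s)"
  proof (rule Bochner_Integration.integrable_bound[OF integrable_pair_mult[OF p integrable_mult_right[OF integrable_indicator_cube, of Q R]]])
    show "(\<lambda>(x, s). k x s) \<in> borel_measurable (lborel \<Otimes>\<^sub>M lborel)"
      unfolding k_def by measurable
  qed (use b in \<open>auto intro!: AE_I2\<close>)
  have "(LINT x|lborel. ?p x * deconv_kernel f R \<theta> x) = (LINT x|lborel. LINT s|lborel. k x s)"
    unfolding k_def deconv_kernel_def set_lebesgue_integral_def real_scaleR_def
    by (simp only: integral_mult_right_zero)
  also have "\<dots> = (LINT s|lborel. LINT x|lborel. k x s)"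
    by (rule lborel_pair.Fubini_integral[OF k, symmetric])
  also have "\<dots> = (LINT s:cube R|lborel. Re (fourier g s * iexp (s \<bullet> \<theta>)))"
    unfolding set_lebesgue_integral_def
  proof (intro Bochner_Integration.integral_cong refl)
    fix s
    have re: "fourier f s = complex_of_real (Re (fourier f s))"
      by (rule fourier_real_if_symmetric[OF fm sym, symmetric])
    have nz': "Re (fourier f s) \<noteq> 0"
      using nz[of s] re by auto
    have i: "integrable lborel (\<lambda>x. complex_of_real (?p x) * iexp (- (s \<bullet> x)))"
      by (rule Bochner_Integration.integrable_bound[OF p]) (auto simp: norm_mult)
    have i': "integrable lborel (\<lambda>x. complex_of_real (?p x) * iexp (- (s \<bullet> x)) * iexp (s \<bullet> \<theta>))"
      using i by (rule integrable_mult_left)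
    have "(LINT x|lborel. ?p x * cos (s \<bullet> (\<theta> - x))) =
        (LINT x|lborel. Re (complex_of_real (?p x) * iexp (- (s \<bullet> x)) * iexp (s \<bullet> \<theta>)))"
    proof (intro Bochner_Integration.integral_cong refl)
      fix x
      have "iexp (- (s \<bullet> x)) * iexp (s \<bullet> \<theta>) = iexp (s \<bullet> (\<theta> - x))"
        by (simp add: inner_diff_right right_diff_distrib mult_exp_exp)
      then have E: "complex_of_real (?p x) * iexp (- (s \<bullet> x)) * iexp (s \<bullet> \<theta>) = complex_of_real (?p x) * cis (s \<bullet> (\<theta> - x))"
        by (simp only: mult.assoc cis_conv_exp)
      show "?p x * cos (s \<bullet> (\<theta> - x)) = Re (complex_of_real (?p x) * iexp (- (s \<bullet> x)) * iexp (s \<bullet> \<theta>))"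
        unfolding E by simp
    qed
    also have "\<dots> = Re (fourier ?p s * iexp (s \<bullet> \<theta>))"
      unfolding integral_Re[OF i'] fourier_eq_iexp by (simp only: integral_mult_left_zero)
    also have "\<dots> = Re (fourier f s) * Re (fourier g s * iexp (s \<bullet> \<theta>))"
    proof -
      have Re_mult: "Re (complex_of_real r * z) = r * Re z" for r z
        by simp
      have "fourier ?p s * iexp (s \<bullet> \<theta>) = complex_of_real (Re (fourier f s)) * (fourier g s * iexp (s \<bullet> \<theta>))"
        by (subst fourier_mixture_pdf[OF f g]) (use gT in \<open>simp_all only: re[symmetric] mult.assoc\<close>)
      then show ?thesis
        by (simp only: Re_mult)
    qed
    finally have cosint: "(LINT x|lborel. ?p x * cos (s \<bullet> (\<theta> - x))) = Re (fourier f s) * Re (fourier g s * iexp (s \<bullet> \<theta>))" .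
    have "(LINT x|lborel. k x s) = (LINT x|lborel. indicator (cube R) s / Re (fourier f s) * (?p x * cos (s \<bullet> (\<theta> - x))))"
      unfolding k_def by (intro Bochner_Integration.integral_cong refl) simp
    also have "\<dots> = indicator (cube R) s / Re (fourier f s) * (Re (fourier f s) * Re (fourier g s * iexp (s \<bullet> \<theta>)))"
      by (simp only: integral_mult_right_zero cosint)
    also have "\<dots> = indicator (cube R) s *\<^sub>R Re (fourier g s * iexp (s \<bullet> \<theta>))"
      using nz' by simp
    finally show "(LINT x|lborel. k x s) = indicator (cube R) s *\<^sub>R Re (fourier g s * iexp (s \<bullet> \<theta>))" .
  qed
  finally show ?thesis .
qed

lemma
  fixes f g :: "real ^ 'd \<Rightarrow> real" and M :: "'w measure"
  assumes f: "integrable lborel f" "\<And>x. 0 \<le> f x" and sym: "\<And>x. f x = f (- x)"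
    and g: "integrable lborel g" "\<And>x. 0 \<le> g x" and gT: "\<And>\<theta>. \<theta> \<notin> \<Theta> \<Longrightarrow> g \<theta> = 0"
    and nz: "\<And>s. fourier f s \<noteq> 0"
    and Q: "\<And>s. s \<in> cube R \<Longrightarrow> 1 / \<bar>Re (fourier f s)\<bar> \<le> Q"
    and iid: "iid_sample M n X (mixture_pdf \<Theta> f g)" and n: "n \<ge> 1" and R: "R \<ge> 0"
  shows expectation_deconv_estimator:
      "prob_space.expectation M (\<lambda>\<omega>. deconv_estimator f n R (\<lambda>i. X i \<omega>) \<theta>) =
        1 / (2 * pi) ^ CARD('d) * (LINT s:cube R|lborel. Re (fourier g s * iexp (s \<bullet> \<theta>)))"
    and variance_deconv_estimator_le:
      "prob_space.variance M (\<lambda>\<omega>. deconv_estimator f n R (\<lambda>i. X i \<omega>) \<theta>) \<le>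
        (Q * (2 * R) ^ CARD('d) / (2 * pi) ^ CARD('d))\<^sup>2 / real n"
proof -
  interpret prob_space M
    using iid by (simp add: iid_sample_def)
  have [measurable]: "f \<in> borel_measurable borel"
    using f by auto
  let ?p = "mixture_pdf \<Theta> f g" and ?c = "(2 * pi) ^ CARD('d)"
  define Z where "Z i \<omega> = deconv_kernel f R \<theta> (X i \<omega>) / (real n * ?c)" for i \<omega>
  have est: "deconv_estimator f n R (\<lambda>i. X i \<omega>) \<theta> = (\<Sum>i\<in>{1..n}. Z i \<omega>)" for \<omega>
    by (simp add: deconv_estimator_eq_sum Z_def)
  have ind: "indep_vars (\<lambda>_. borel) X {1..n}" and dist: "\<And>i. i \<in> {1..n} \<Longrightarrow> distributed M lborel (X i) (\<lambda>x. ennreal (?p x))"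
    using iid by (auto simp: iid_sample_def)
  have indZ: "indep_vars (\<lambda>_. borel) Z {1..n}"
    unfolding Z_def by (rule indep_vars_compose2[OF ind]) auto
  have rv [measurable]: "random_variable borel (X i)" if "i \<in> {1..n}" for i
    using ind that unfolding indep_vars_def2 by auto
  have kb: "\<bar>deconv_kernel f R \<theta> x\<bar> \<le> Q * (2 * R) ^ CARD('d)" for x
    by (rule deconv_kernel_bound[OF _ Q R]) auto
  let ?K = "Q * (2 * R) ^ CARD('d) / (real n * ?c)"
  have Zb: "\<bar>Z i \<omega>\<bar> \<le> ?K" for i \<omega>
  proof -
    have "\<bar>Z i \<omega>\<bar> = \<bar>deconv_kernel f R \<theta> (X i \<omega>)\<bar> / (real n * ?c)"
      by (simp add: Z_def abs_divide)
    also have "\<dots> \<le> ?K"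
      by (intro divide_right_mono kb) simp
    finally show ?thesis .
  qed
  have Zm [measurable]: "random_variable borel (Z i)" if "i \<in> {1..n}" for i
    unfolding Z_def using rv[OF that] by measurable
  have Zi: "integrable M (Z i)" if "i \<in> {1..n}" for i
    using Zm[OF that] Zb by (auto intro!: integrable_const_bound[where B = ?K])
  have p0: "0 \<le> ?p x" for x
    by (subst mixture_pdf_eq[OF gT]) (auto intro!: Bochner_Integration.integral_nonneg mult_nonneg_nonneg f g)
  let ?I = "LINT s:cube R|lborel. Re (fourier g s * iexp (s \<bullet> \<theta>))"
  have EZ: "expectation (Z i) = ?I / (real n * ?c)" if i: "i \<in> {1..n}" for i
  proof -
    have "expectation (\<lambda>\<omega>. deconv_kernel f R \<theta> (X i \<omega>)) = (LINT x|lborel. ?p x * deconv_kernel f R \<theta> x)"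
      by (rule distributed_integral[OF dist[OF i], symmetric]) (auto simp: p0)
    also have "\<dots> = ?I"
      by (rule integral_deconv_kernel[OF f(1) sym g(1) gT nz Q])
    finally show ?thesis
      by (simp only: Z_def[abs_def] integral_divide_zero)
  qed
  show "expectation (\<lambda>\<omega>. deconv_estimator f n R (\<lambda>i. X i \<omega>) \<theta>) = 1 / ?c * ?I"
    unfolding est using n by (simp add: Zi EZ del: times_complex.sel)
  have "variance (\<lambda>\<omega>. \<Sum>i\<in>{1..n}. Z i \<omega>) \<le> card {1..n} * ?K\<^sup>2"
    by (rule variance_sum_indep_le[OF _ indZ Zb]) auto
  also have "\<dots> = (Q * (2 * R) ^ CARD('d) / ?c)\<^sup>2 / real n"
  proof -
    have "real n * (a / (real n * c))\<^sup>2 = (a / c)\<^sup>2 / real n" for a c :: real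
      using n by (simp add: power2_eq_square)
    then show ?thesis
      by simp
  qed
  finally show "variance (\<lambda>\<omega>. deconv_estimator f n R (\<lambda>i. X i \<omega>) \<theta>) \<le> (Q * (2 * R) ^ CARD('d) / ?c)\<^sup>2 / real n"
    unfolding est .
qed

lemma pdf_integrable: "pdf h \<Longrightarrow> integrable lborel h"
  by (intro integrableI_bounded) (auto simp: pdf_def)

text \<open>Both parts of the final theorem are instances for different envelopes \<open>h\<close>.  Neither constant
  depends on \<open>R\<close> or \<open>n\<close>, nor does the exceptional null set.\<close>

lemma deconv_risk_bounds:
  fixes f g :: "real ^ 'd \<Rightarrow> real"
  assumes f: "pdf f" and sym: "\<And>x. f x = f (- x)"
    and \<beta>: "\<beta> > 0" and low: "lower_ordinary_smooth \<beta> f" and g: "pdf_on \<Theta> g"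
    and h: "integrable lborel h" and h0: "\<And>x. 0 \<le> h x"
    and A: "A \<ge> 0" and up: "\<And>s. norm (fourier g s) \<le> A * (\<Prod>j\<in>UNIV. h (s $ j))"
  obtains B V :: real where "B > 0" "V > 0"
    and "AE \<theta> in lborel. \<forall>(M :: 'w measure) X n R.
      n \<ge> 1 \<and> R \<ge> 0 \<and> iid_sample M n X (mixture_pdf \<Theta> f g) \<longrightarrow>
      \<bar>prob_space.expectation M (\<lambda>\<omega>. deconv_estimator f n R (\<lambda>i. X i \<omega>) \<theta>) - g \<theta>\<bar>
        \<le> B * (LINT x|lborel. indicator {x. R < \<bar>x\<bar>} x * h x) \<and>
      prob_space.variance M (\<lambda>\<omega>. deconv_estimator f n R (\<lambda>i. X i \<omega>) \<theta>)
        \<le> V * ((1 + R powr \<beta>) * R) ^ (2 * CARD('d)) / real n"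
proof -
  obtain c0 where c0: "c0 > 0" and lb: "\<And>s. norm (fourier f s) \<ge> c0 * (\<Prod>j\<in>UNIV. 1 / (1 + \<bar>s $ j\<bar> powr \<beta>))"
    using low by (auto simp: lower_ordinary_smooth_def)
  have f': "integrable lborel f" "\<And>x. 0 \<le> f x" "f \<in> borel_measurable borel"
    and g': "integrable lborel g" "\<And>x. 0 \<le> g x" "\<And>\<theta>. \<theta> \<notin> \<Theta> \<Longrightarrow> g \<theta> = 0"
    using f g pdf_integrable by (auto simp: pdf_def pdf_on_def)
  have nz: "fourier f s \<noteq> 0" for s
  proof -
    have "0 < c0 * (\<Prod>j\<in>UNIV. 1 / (1 + \<bar>s $ j\<bar> powr \<beta>))"
      using c0 by (intro mult_pos_pos prod_pos) (auto simp: add_pos_nonneg)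
    with lb[of s] show ?thesis by auto
  qed
  let ?c = "(2 * pi) ^ CARD('d)"
  \<comment> \<open>adding \<open>1\<close> keeps \<open>B\<close> positive even when \<open>A = 0\<close>\<close>
  define B where "B = A * (CARD('d) * (LINT x|lborel. h x) ^ (CARD('d) - 1)) / ?c + 1"
  define V where "V = (2 ^ CARD('d) / (c0 * ?c))\<^sup>2"
  show ?thesis
  proof
    show "B > 0"
      unfolding B_def using A h0 by (intro add_nonneg_pos divide_nonneg_nonneg mult_nonneg_nonneg zero_le_power) auto
    show "V > 0"
      unfolding V_def using c0 by (intro zero_less_power divide_pos_pos mult_pos_pos) auto
    show "AE \<theta> in lborel. \<forall>(M :: 'w measure) X n R.
      n \<ge> 1 \<and> R \<ge> 0 \<and> iid_sample M n X (mixture_pdf \<Theta> f g) \<longrightarrow>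
      \<bar>prob_space.expectation M (\<lambda>\<omega>. deconv_estimator f n R (\<lambda>i. X i \<omega>) \<theta>) - g \<theta>\<bar>
        \<le> B * (LINT x|lborel. indicator {x. R < \<bar>x\<bar>} x * h x) \<and>
      prob_space.variance M (\<lambda>\<omega>. deconv_estimator f n R (\<lambda>i. X i \<omega>) \<theta>)
        \<le> V * ((1 + R powr \<beta>) * R) ^ (2 * CARD('d)) / real n"
      using truncated_inversion_error[OF g'(1,2) h h0 A up]
    proof (eventually_elim, intro allI impI, elim conjE)
      fix \<theta> and M :: "'w measure" and X n and R :: real
      assume err: "\<forall>R. \<bar>1 / ?c * (LINT s:cube R|lborel. Re (fourier g s * iexp (s \<bullet> \<theta>))) - g \<theta>\<bar> \<le>
          A * (CARD('d) * (LINT x|lborel. h x) ^ (CARD('d) - 1)) / ?c * (LINT x|lborel. indicator {x. R < \<bar>x\<bar>} x * h x)"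
        and n: "n \<ge> 1" and R: "R \<ge> 0" and iid: "iid_sample M n X (mixture_pdf \<Theta> f g)"
      let ?Q = "(1 + R powr \<beta>) ^ CARD('d) / c0"
      have Q: "1 / \<bar>Re (fourier f s)\<bar> \<le> ?Q" if "s \<in> cube R" for s
        by (rule inverse_fourier_bound_on_cube[OF f'(3) sym c0 lb \<beta> that])
      let ?T = "LINT x|lborel. indicator {x. R < \<bar>x\<bar>} x * h x"
      have T: "0 \<le> ?T"
        using h0 by (intro Bochner_Integration.integral_nonneg) auto
      have "\<bar>prob_space.expectation M (\<lambda>\<omega>. deconv_estimator f n R (\<lambda>i. X i \<omega>) \<theta>) - g \<theta>\<bar> \<le> (B - 1) * ?T"
      proof -
        have "prob_space.expectation M (\<lambda>\<omega>. deconv_estimator f n R (\<lambda>i. X i \<omega>) \<theta>) =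
            1 / ?c * (LINT s:cube R|lborel. Re (fourier g s * iexp (s \<bullet> \<theta>)))"
          by (rule expectation_deconv_estimator[OF f'(1,2) sym g' nz Q iid n R])
        then show ?thesis
          unfolding B_def add_diff_cancel_right' using err by (simp only:)
      qed
      also have "\<dots> \<le> B * ?T"
        using T by (intro mult_right_mono) auto
      finally have E: "\<bar>prob_space.expectation M (\<lambda>\<omega>. deconv_estimator f n R (\<lambda>i. X i \<omega>) \<theta>) - g \<theta>\<bar> \<le> B * ?T" .
      have "prob_space.variance M (\<lambda>\<omega>. deconv_estimator f n R (\<lambda>i. X i \<omega>) \<theta>) \<le>
          (?Q * (2 * R) ^ CARD('d) / ?c)\<^sup>2 / real n"
        by (rule variance_deconv_estimator_le[OF f'(1,2) sym g' nz Q iid n R])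
      also have "(?Q * (2 * R) ^ CARD('d) / ?c)\<^sup>2 = V * ((1 + R powr \<beta>) * R) ^ (2 * CARD('d))"
        unfolding V_def power_mult mult.commute[of 2 "CARD('d)"]
        by (simp add: power_mult_distrib power_divide)
      finally show "\<bar>prob_space.expectation M (\<lambda>\<omega>. deconv_estimator f n R (\<lambda>i. X i \<omega>) \<theta>) - g \<theta>\<bar> \<le> B * ?T \<and>
          prob_space.variance M (\<lambda>\<omega>. deconv_estimator f n R (\<lambda>i. X i \<omega>) \<theta>) \<le> V * ((1 + R powr \<beta>) * R) ^ (2 * CARD('d)) / real n"
        using E by simp
    qed
  qed
qed

section \<open>Rates of convergence\<close>

text \<open>Away from \<open>0\<close> the constant \<open>1\<close> is dominated by a multiple of \<open>R powr \<beta>\<close>, which leaves a pure power of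
  \<open>R\<close>.\<close>

lemma variance_factor_le:
  fixes R C' \<beta> :: real
  assumes C': "C' > 0" and R: "R \<ge> C'" and \<beta>: "\<beta> > 0"
  shows "((1 + R powr \<beta>) * R) ^ (2 * d) \<le> (1 + C' powr (- \<beta>)) ^ (2 * d) * R powr ((2 + 2 * \<beta>) * real d)"
proof -
  have R0: "R > 0" using C' R by simp
  have "1 = R powr (- \<beta>) * R powr \<beta>"
    using R0 by (simp flip: powr_add)
  also have "\<dots> \<le> C' powr (- \<beta>) * R powr \<beta>"
    using C' R \<beta> by (intro mult_right_mono powr_mono2') auto
  finally have "(1 + R powr \<beta>) * R \<le> ((1 + C' powr (- \<beta>)) * R powr \<beta>) * R"
    using R0 by (intro mult_right_mono) (auto simp: distrib_right)
  also have "\<dots> = (1 + C' powr (- \<beta>)) * R powr (1 + \<beta>)"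
    using R0 by (simp add: powr_add)
  finally have "((1 + R powr \<beta>) * R) ^ (2 * d) \<le> ((1 + C' powr (- \<beta>)) * R powr (1 + \<beta>)) ^ (2 * d)"
    using R0 by (intro power_mono) (auto simp: add_nonneg_nonneg)
  also have "\<dots> = (1 + C' powr (- \<beta>)) ^ (2 * d) * (R powr (1 + \<beta>)) ^ (2 * d)"
    by (rule power_mult_distrib)
  also have "(R powr (1 + \<beta>)) ^ (2 * d) = R powr ((2 + 2 * \<beta>) * real d)"
    using R0 by (subst powr_realpow[symmetric]) (auto simp: powr_powr algebra_simps)
  finally show ?thesis .
qed

text \<open>For part (a), \<open>C'\<close> is the threshold of \<open>supersmooth_tail\<close>, and one \<open>C\<close> has to serve bias and variance.
  In part (b) the bias constant works for every \<open>R > 0\<close>, since the tail bound does; only the variance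
  constant depends on the lower bound \<open>C'\<close> for \<open>R\<close>.\<close>

theorem theorem6:
  fixes f g :: "real ^ 'd \<Rightarrow> real" and \<Theta> :: "(real ^ 'd) set" and \<beta>1 :: real
  assumes "pdf f" and "\<And>x. f x = f (- x)"
    and "\<beta>1 > 0" and "lower_ordinary_smooth \<beta>1 f"
    and "pdf_on \<Theta> g" and "esssup lborel (\<lambda>x. ereal \<bar>g x\<bar>) < \<infinity>"
  shows
    "(\<forall>\<alpha> C0 C1. \<alpha> > 0 \<and> upper_supersmooth \<alpha> C0 C1 g \<longrightarrow>
       (\<exists>C>0. \<exists>C'>0. AE \<theta> in lborel. \<theta> \<in> \<Theta> \<longrightarrow>
          (\<forall>(M :: 'w measure) X n R.
             n \<ge> 1 \<and> R \<ge> C' \<and> iid_sample M n X (mixture_pdf \<Theta> f g) \<longrightarrow>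
             \<bar>prob_space.expectation M (\<lambda>\<omega>. deconv_estimator f n R (\<lambda>i. X i \<omega>) \<theta>) - g \<theta>\<bar>
               \<le> C * R powr max (1 - \<alpha>) 0 * exp (- C1 * R powr \<alpha>) \<and>
             prob_space.variance M (\<lambda>\<omega>. deconv_estimator f n R (\<lambda>i. X i \<omega>) \<theta>)
               \<le> C * (R powr ((2 + 2 * \<beta>1) * real CARD('d)) / real n))))
     \<and>
     (\<forall>\<beta>2. \<beta>2 > 1 \<and> upper_ordinary_smooth \<beta>2 g \<longrightarrow>
       (\<exists>c>0. \<forall>C'>0. \<exists>C>0. AE \<theta> in lborel. \<theta> \<in> \<Theta> \<longrightarrow>
          (\<forall>(M :: 'w measure) X n R.
             n \<ge> 1 \<and> R > 0 \<and> iid_sample M n X (mixture_pdf \<Theta> f g) \<longrightarrow>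
             \<bar>prob_space.expectation M (\<lambda>\<omega>. deconv_estimator f n R (\<lambda>i. X i \<omega>) \<theta>) - g \<theta>\<bar>
               \<le> c / R powr (\<beta>2 - 1) \<and>
             (R \<ge> C' \<longrightarrow>
                prob_space.variance M (\<lambda>\<omega>. deconv_estimator f n R (\<lambda>i. X i \<omega>) \<theta>)
                  \<le> C * (R powr ((2 + 2 * \<beta>1) * real CARD('d)) / real n)))))"
proof (intro conjI allI impI)
  fix \<alpha> C0 C1 :: real
  assume "\<alpha> > 0 \<and> upper_supersmooth \<alpha> C0 C1 g"
  then have \<alpha>: "\<alpha> > 0" and C0: "C0 > 0" and C1: "C1 > 0"
    and up: "\<And>s. norm (fourier g s) \<le> C0 * exp (- C1 * (\<Sum>j\<in>UNIV. \<bar>s $ j\<bar> powr \<alpha>))"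
    by (auto simp: upper_supersmooth_def)
  let ?h = "\<lambda>x. exp (- C1 * \<bar>x\<bar> powr \<alpha>)"
  have up': "norm (fourier g s) \<le> C0 * (\<Prod>j\<in>UNIV. ?h (s $ j))" for s
    using up[of s] by (simp only: sum_distrib_left exp_sum[OF finite])
  have h0: "0 \<le> ?h x" for x
    by simp
  obtain B V where B: "B > 0" and V: "V > 0" and bd: "AE \<theta> in lborel. \<forall>(M :: 'w measure) X n R.
      n \<ge> 1 \<and> R \<ge> 0 \<and> iid_sample M n X (mixture_pdf \<Theta> f g) \<longrightarrow>
      \<bar>prob_space.expectation M (\<lambda>\<omega>. deconv_estimator f n R (\<lambda>i. X i \<omega>) \<theta>) - g \<theta>\<bar>
        \<le> B * (LINT x|lborel. indicator {x. R < \<bar>x\<bar>} x * ?h x) \<and>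
      prob_space.variance M (\<lambda>\<omega>. deconv_estimator f n R (\<lambda>i. X i \<omega>) \<theta>)
        \<le> V * ((1 + R powr \<beta>1) * R) ^ (2 * CARD('d)) / real n"
    by (rule deconv_risk_bounds[OF assms(1-5) supersmooth_tail(1)[OF \<alpha> C1] h0 less_imp_le[OF C0] up'])
  define C' where "C' = max 1 ((2 / (C1 * \<alpha>)) powr (1 / \<alpha>))"
  define C where "C = max (B * (4 / (C1 * \<alpha>))) (V * (1 + C' powr (- \<beta>1)) ^ (2 * CARD('d)))"
  have C'0: "C' > 0"
    by (simp add: C'_def)
  have C0: "C > 0"
    using B \<alpha> C1 by (simp add: C_def less_max_iff_disj)
  show "\<exists>C>0. \<exists>C'>0. AE \<theta> in lborel. \<theta> \<in> \<Theta> \<longrightarrow>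
          (\<forall>(M :: 'w measure) X n R.
             n \<ge> 1 \<and> R \<ge> C' \<and> iid_sample M n X (mixture_pdf \<Theta> f g) \<longrightarrow>
             \<bar>prob_space.expectation M (\<lambda>\<omega>. deconv_estimator f n R (\<lambda>i. X i \<omega>) \<theta>) - g \<theta>\<bar>
               \<le> C * R powr max (1 - \<alpha>) 0 * exp (- C1 * R powr \<alpha>) \<and>
             prob_space.variance M (\<lambda>\<omega>. deconv_estimator f n R (\<lambda>i. X i \<omega>) \<theta>)
               \<le> C * (R powr ((2 + 2 * \<beta>1) * real CARD('d)) / real n))"
  proof (rule exI[of _ C], rule conjI[OF C0], rule exI[of _ C'], rule conjI[OF C'0])
    show "AE \<theta> in lborel. \<theta> \<in> \<Theta> \<longrightarrow>
          (\<forall>(M :: 'w measure) X n R.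
             n \<ge> 1 \<and> R \<ge> C' \<and> iid_sample M n X (mixture_pdf \<Theta> f g) \<longrightarrow>
             \<bar>prob_space.expectation M (\<lambda>\<omega>. deconv_estimator f n R (\<lambda>i. X i \<omega>) \<theta>) - g \<theta>\<bar>
               \<le> C * R powr max (1 - \<alpha>) 0 * exp (- C1 * R powr \<alpha>) \<and>
             prob_space.variance M (\<lambda>\<omega>. deconv_estimator f n R (\<lambda>i. X i \<omega>) \<theta>)
               \<le> C * (R powr ((2 + 2 * \<beta>1) * real CARD('d)) / real n))"
      using bd
    proof (eventually_elim, intro allI impI)
      fix \<theta> and M :: "'w measure" and X :: "nat \<Rightarrow> 'w \<Rightarrow> real ^ 'd" and n and R :: real
      let ?est = "\<lambda>\<omega>. deconv_estimator f n R (\<lambda>i. X i \<omega>) \<theta>"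
      assume bounds: "\<forall>(M :: 'w measure) X n R.
          n \<ge> 1 \<and> R \<ge> 0 \<and> iid_sample M n X (mixture_pdf \<Theta> f g) \<longrightarrow>
          \<bar>prob_space.expectation M (\<lambda>\<omega>. deconv_estimator f n R (\<lambda>i. X i \<omega>) \<theta>) - g \<theta>\<bar>
            \<le> B * (LINT x|lborel. indicator {x. R < \<bar>x\<bar>} x * ?h x) \<and>
          prob_space.variance M (\<lambda>\<omega>. deconv_estimator f n R (\<lambda>i. X i \<omega>) \<theta>)
            \<le> V * ((1 + R powr \<beta>1) * R) ^ (2 * CARD('d)) / real n"
        and sample: "n \<ge> 1 \<and> R \<ge> C' \<and> iid_sample M n X (mixture_pdf \<Theta> f g)"
      from sample have R: "R \<ge> C'" "R \<ge> 0" using C'0 by auto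
      from sample R have "n \<ge> 1 \<and> R \<ge> 0 \<and> iid_sample M n X (mixture_pdf \<Theta> f g)"
        by blast
      note at_R = bounds[rule_format, OF this]
      have E: "B * (LINT x|lborel. indicator {x. R < \<bar>x\<bar>} x * ?h x) \<le> C * R powr max (1 - \<alpha>) 0 * exp (- C1 * R powr \<alpha>)"
      proof -
        have "B * (LINT x|lborel. indicator {x. R < \<bar>x\<bar>} x * ?h x) \<le>
            B * (4 / (C1 * \<alpha>) * (R powr max (1 - \<alpha>) 0 * exp (- C1 * R powr \<alpha>)))"
          using B R by (intro mult_left_mono supersmooth_tail(2)[OF \<alpha> C1]) (auto simp: C'_def)
        also have "\<dots> = B * (4 / (C1 * \<alpha>)) * (R powr max (1 - \<alpha>) 0 * exp (- C1 * R powr \<alpha>))"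
          by (simp only: mult.assoc)
        also have "\<dots> \<le> C * (R powr max (1 - \<alpha>) 0 * exp (- C1 * R powr \<alpha>))"
          by (intro mult_right_mono) (auto simp: C_def)
        finally show ?thesis by (simp only: mult.assoc)
      qed
      have W: "V * ((1 + R powr \<beta>1) * R) ^ (2 * CARD('d)) / real n \<le> C * (R powr ((2 + 2 * \<beta>1) * real CARD('d)) / real n)"
      proof -
        have "V * ((1 + R powr \<beta>1) * R) ^ (2 * CARD('d)) \<le>
            V * ((1 + C' powr (- \<beta>1)) ^ (2 * CARD('d)) * R powr ((2 + 2 * \<beta>1) * real CARD('d)))"
          using V by (intro mult_left_mono variance_factor_le C'0 R assms) auto
        also have "\<dots> \<le> C * R powr ((2 + 2 * \<beta>1) * real CARD('d))"
          unfolding mult.assoc[symmetric] by (intro mult_right_mono) (auto simp: C_def)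
        finally show ?thesis
          by (simp add: divide_right_mono)
      qed
      show "\<bar>prob_space.expectation M ?est - g \<theta>\<bar>
              \<le> C * R powr max (1 - \<alpha>) 0 * exp (- C1 * R powr \<alpha>) \<and>
            prob_space.variance M ?est \<le> C * (R powr ((2 + 2 * \<beta>1) * real CARD('d)) / real n)"
        by (rule conjI[OF order.trans[OF conjunct1[OF at_R] E] order.trans[OF conjunct2[OF at_R] W]])
    qed
  qed
next
  fix \<beta>2 :: real
  assume "\<beta>2 > 1 \<and> upper_ordinary_smooth \<beta>2 g"
  then obtain c0 where \<beta>2: "\<beta>2 > 1" and c0: "c0 > 0"
    and up: "\<And>s. norm (fourier g s) \<le> c0 * (\<Prod>j\<in>UNIV. 1 / (1 + \<bar>s $ j\<bar> powr \<beta>2))"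
    by (auto simp: upper_ordinary_smooth_def)
  let ?h = "\<lambda>x. 1 / (1 + \<bar>x\<bar> powr \<beta>2)"
  have h0: "0 \<le> ?h x" for x
    by simp
  obtain B V where B: "B > 0" and V: "V > 0" and bd: "AE \<theta> in lborel. \<forall>(M :: 'w measure) X n R.
      n \<ge> 1 \<and> R \<ge> 0 \<and> iid_sample M n X (mixture_pdf \<Theta> f g) \<longrightarrow>
      \<bar>prob_space.expectation M (\<lambda>\<omega>. deconv_estimator f n R (\<lambda>i. X i \<omega>) \<theta>) - g \<theta>\<bar>
        \<le> B * (LINT x|lborel. indicator {x. R < \<bar>x\<bar>} x * ?h x) \<and>
      prob_space.variance M (\<lambda>\<omega>. deconv_estimator f n R (\<lambda>i. X i \<omega>) \<theta>)
        \<le> V * ((1 + R powr \<beta>1) * R) ^ (2 * CARD('d)) / real n"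
    by (rule deconv_risk_bounds[OF assms(1-5) ordinary_smooth_tail(1)[OF \<beta>2] h0 less_imp_le[OF c0] up])
  define c where "c = B * (2 / (\<beta>2 - 1))"
  have c: "c > 0"
    using B \<beta>2 by (simp add: c_def)
  show "\<exists>c>0. \<forall>C'>0. \<exists>C>0. AE \<theta> in lborel. \<theta> \<in> \<Theta> \<longrightarrow>
          (\<forall>(M :: 'w measure) X n R.
             n \<ge> 1 \<and> R > 0 \<and> iid_sample M n X (mixture_pdf \<Theta> f g) \<longrightarrow>
             \<bar>prob_space.expectation M (\<lambda>\<omega>. deconv_estimator f n R (\<lambda>i. X i \<omega>) \<theta>) - g \<theta>\<bar>
               \<le> c / R powr (\<beta>2 - 1) \<and>
             (R \<ge> C' \<longrightarrow>
                prob_space.variance M (\<lambda>\<omega>. deconv_estimator f n R (\<lambda>i. X i \<omega>) \<theta>)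
                  \<le> C * (R powr ((2 + 2 * \<beta>1) * real CARD('d)) / real n)))"
  proof (rule exI[of _ c], rule conjI[OF c], intro allI impI)
    fix C' :: real assume C': "C' > 0"
    define C where "C = V * (1 + C' powr (- \<beta>1)) ^ (2 * CARD('d))"
    have C0: "C > 0"
      unfolding C_def using V by (intro mult_pos_pos zero_less_power) (auto simp: add_pos_nonneg)
    have "AE \<theta> in lborel. \<theta> \<in> \<Theta> \<longrightarrow>
          (\<forall>(M :: 'w measure) X n R.
             n \<ge> 1 \<and> R > 0 \<and> iid_sample M n X (mixture_pdf \<Theta> f g) \<longrightarrow>
             \<bar>prob_space.expectation M (\<lambda>\<omega>. deconv_estimator f n R (\<lambda>i. X i \<omega>) \<theta>) - g \<theta>\<bar>
               \<le> c / R powr (\<beta>2 - 1) \<and>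
             (R \<ge> C' \<longrightarrow>
                prob_space.variance M (\<lambda>\<omega>. deconv_estimator f n R (\<lambda>i. X i \<omega>) \<theta>)
                  \<le> C * (R powr ((2 + 2 * \<beta>1) * real CARD('d)) / real n)))"
      using bd
    proof (eventually_elim, intro allI impI)
      fix \<theta> and M :: "'w measure" and X :: "nat \<Rightarrow> 'w \<Rightarrow> real ^ 'd" and n and R :: real
      let ?est = "\<lambda>\<omega>. deconv_estimator f n R (\<lambda>i. X i \<omega>) \<theta>"
      assume bounds: "\<forall>(M :: 'w measure) X n R.
          n \<ge> 1 \<and> R \<ge> 0 \<and> iid_sample M n X (mixture_pdf \<Theta> f g) \<longrightarrow>
          \<bar>prob_space.expectation M (\<lambda>\<omega>. deconv_estimator f n R (\<lambda>i. X i \<omega>) \<theta>) - g \<theta>\<bar>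
            \<le> B * (LINT x|lborel. indicator {x. R < \<bar>x\<bar>} x * ?h x) \<and>
          prob_space.variance M (\<lambda>\<omega>. deconv_estimator f n R (\<lambda>i. X i \<omega>) \<theta>)
            \<le> V * ((1 + R powr \<beta>1) * R) ^ (2 * CARD('d)) / real n"
        and sample: "n \<ge> 1 \<and> R > 0 \<and> iid_sample M n X (mixture_pdf \<Theta> f g)"
      from sample have R: "R > 0" by blast
      from sample R have "n \<ge> 1 \<and> R \<ge> 0 \<and> iid_sample M n X (mixture_pdf \<Theta> f g)"
        by (meson less_imp_le)
      note at_R = bounds[rule_format, OF this]
      have E: "B * (LINT x|lborel. indicator {x. R < \<bar>x\<bar>} x * ?h x) \<le> c / R powr (\<beta>2 - 1)"
        using mult_left_mono[OF ordinary_smooth_tail(2)[OF \<beta>2 R], of B] B by (simp add: c_def)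
      have W: "V * ((1 + R powr \<beta>1) * R) ^ (2 * CARD('d)) / real n \<le> C * (R powr ((2 + 2 * \<beta>1) * real CARD('d)) / real n)"
        if "C' \<le> R"
      proof -
        have "V * ((1 + R powr \<beta>1) * R) ^ (2 * CARD('d)) \<le> C * R powr ((2 + 2 * \<beta>1) * real CARD('d))"
          unfolding C_def mult.assoc using V that by (intro mult_left_mono variance_factor_le C' assms) auto
        then show ?thesis
          by (simp add: divide_right_mono)
      qed
      show "\<bar>prob_space.expectation M ?est - g \<theta>\<bar> \<le> c / R powr (\<beta>2 - 1) \<and>
            (R \<ge> C' \<longrightarrow>
              prob_space.variance M ?est \<le> C * (R powr ((2 + 2 * \<beta>1) * real CARD('d)) / real n))"
        by (intro conjI impI order.trans[OF conjunct1[OF at_R] E] order.trans[OF conjunct2[OF at_R] W])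
    qed
    with C0 show "\<exists>C>0. AE \<theta> in lborel. \<theta> \<in> \<Theta> \<longrightarrow>
          (\<forall>(M :: 'w measure) X n R.
             n \<ge> 1 \<and> R > 0 \<and> iid_sample M n X (mixture_pdf \<Theta> f g) \<longrightarrow>
             \<bar>prob_space.expectation M (\<lambda>\<omega>. deconv_estimator f n R (\<lambda>i. X i \<omega>) \<theta>) - g \<theta>\<bar>
               \<le> c / R powr (\<beta>2 - 1) \<and>
             (R \<ge> C' \<longrightarrow>
                prob_space.variance M (\<lambda>\<omega>. deconv_estimator f n R (\<lambda>i. X i \<omega>) \<theta>)
                  \<le> C * (R powr ((2 + 2 * \<beta>1) * real CARD('d)) / real n)))"
      by blast
  qed
qed

end
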